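(* Let $N\ge 2$ and let $u^1,\dots,u^{N+1}$ be coordinates (on the open set where the map below is a local diffeomorphism). Let $m^{ij}$ be the $(N+1)\times(N+1)$ symmetric constant matrix with $m^{ii}=2-N$ for $1\le i\le N$, $m^{N+1,N+1}=N$, and $m^{ij}=1$ for $i\ne j$, and consider the pair $$g^{ij}(u)=m^{ij}u^iu^j,\qquad \Gamma^{ij}_k(u)=\delta^j_k\,m^{ij}u^i\quad(\text{no summation}).$$ Define new coordinates $s^1,\dots,s^{N+1}$ by $$s^r=\sum_{n=0}^{r}(-1)^n\sigma^{r-n}(u^{N+1})^n\ (r=1,\dots,N),\qquad s^{N+1}=u^{N+1},$$ where $\sigma^0=1$ and $\sigma^r$ are the elementary symmetric polynomials of $u^1,\dots,u^N$. Equivalently, $\frac{\prod_{i=1}^N(p+u^i)}{p+u^{N+1}}=\sum_{n=0}^{N-1}p^ns^{N-1-n}+\frac{s^N}{p+s^{N+1}}$ with $s^0=1$. Transform the pair to the $s$-coordinates by $$g^{ij}(s)=\frac{\partial s^i}{\partial u^p}\frac{\partial s^j}{\partial u^q}g^{pq}(u),\qquad \Gamma^{ij}_k(s)=\frac{\partial s^i}{\partial u^p}\frac{\partial s^j}{\partial u^q}\frac{\partial u^r}{\partial s^k}\Gamma^{pq}_r(u)+\frac{\partial s^i}{\partial u^p}\frac{\partial^2 s^j}{\partial u^q\partial u^r}\frac{\partial u^r}{\partial s^k}g^{pq}(u)$$ (summation over repeated indices). Then all components $g^{ij}(s)$ and $\Gamma^{ij}_k(s)$, regarded as functions of $s^1,\dots,s^{N+1}$,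 depend linearly (affinely) on the coordinate $s^{N-1}$.
   Context: The pair $(g,\Gamma)$ defines the (degenerate) Hamiltonian structure of hydrodynamic type $\{u^i(x),u^j(y)\}=g^{ij}\delta'(x-y)+\Gamma^{ij}_ku^k_x\delta(x-y)$ associated with the rational Lax function $\mathcal L=\prod_{i=1}^N(p+u^i)/(p+u^{N+1})$; the stated transformation rule for $(g,\Gamma)$ is the one induced on the coefficients of this bracket by the change of fields $u\mapsto s$. "Depend linearly on $s^{N-1}$" means the second partial derivative with respect to $s^{N-1}$ (other $s^j$ held fixed) vanishes. *)

theory Defs
  imports "HOL-Analysis.Analysis"
begin

text \<open>Points of coordinate space are functions nat \<Rightarrow> real; only the
coordinates 1..N+1 are used (the others are ignored).\<close>

definition partial :: "nat \<Rightarrow> ((nat \<Rightarrow> real) \<Rightarrow> real) \<Rightarrow> (nat \<Rightarrow> real) \<Rightarrow> real" where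
  "partial k f x = deriv (\<lambda>t. f (x(k := t))) (x k)"

definition esym :: "nat \<Rightarrow> (nat \<Rightarrow> real) \<Rightarrow> nat \<Rightarrow> real" where
  "esym N u r = (\<Sum>S | S \<subseteq> {1..N} \<and> card S = r. \<Prod>i\<in>S. u i)"

definition sfun :: "nat \<Rightarrow> (nat \<Rightarrow> real) \<Rightarrow> nat \<Rightarrow> real" where
  "sfun N u r =
     (if r = N + 1 then u (N + 1)
      else if 1 \<le> r \<and> r \<le> N then
        (\<Sum>n = 0..r. (-1) ^ n * esym N u (r - n) * u (N + 1) ^ n)
      else 0)"

definition mm :: "nat \<Rightarrow> nat \<Rightarrow> nat \<Rightarrow> real" where
  "mm N i j = (if i = j then (if i = N + 1 then real N else 2 - real N) else 1)"

definition gU :: "nat \<Rightarrow> (nat \<Rightarrow> real) \<Rightarrow> nat \<Rightarrow> nat \<Rightarrow> real" where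
  "gU N u p q = mm N p q * u p * u q"

definition GamU :: "nat \<Rightarrow> (nat \<Rightarrow> real) \<Rightarrow> nat \<Rightarrow> nat \<Rightarrow> nat \<Rightarrow> real" where
  "GamU N u p q r = (if q = r then mm N p q * u p else 0)"

definition ds :: "nat \<Rightarrow> (nat \<Rightarrow> real) \<Rightarrow> nat \<Rightarrow> nat \<Rightarrow> real" where
  "ds N u i p = partial p (\<lambda>v. sfun N v i) u"

definition dds :: "nat \<Rightarrow> (nat \<Rightarrow> real) \<Rightarrow> nat \<Rightarrow> nat \<Rightarrow> nat \<Rightarrow> real" where
  "dds N u j q r = partial r (\<lambda>w. partial q (\<lambda>v. sfun N v j) w) u"

definition jac_nonsing :: "nat \<Rightarrow> (nat \<Rightarrow> real) \<Rightarrow> bool" where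
  "jac_nonsing N u \<longleftrightarrow>
     (\<forall>v. (\<forall>i\<in>{1..N+1}. (\<Sum>p = 1..N+1. ds N u i p * v p) = 0)
          \<longrightarrow> (\<forall>p\<in>{1..N+1}. v p = 0))"

text \<open>Transformed pair, as functions of s, using a local inverse phi (s \<mapsto> u);
  du^r/ds^k is the partial derivative of the local inverse.\<close>
definition gS :: "nat \<Rightarrow> ((nat \<Rightarrow> real) \<Rightarrow> (nat \<Rightarrow> real)) \<Rightarrow> nat \<Rightarrow> nat \<Rightarrow> (nat \<Rightarrow> real) \<Rightarrow> real" where
  "gS N \<phi> i j s = (\<Sum>p = 1..N+1. \<Sum>q = 1..N+1.
      ds N (\<phi> s) i p * ds N (\<phi> s) j q * gU N (\<phi> s) p q)"

definition GamS :: "nat \<Rightarrow> ((nat \<Rightarrow> real) \<Rightarrow> (nat \<Rightarrow> real)) \<Rightarrow> nat \<Rightarrow> nat \<Rightarrow> nat \<Rightarrow> (nat \<Rightarrow> real) \<Rightarrow> real" where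
  "GamS N \<phi> i j k s = (\<Sum>p = 1..N+1. \<Sum>q = 1..N+1. \<Sum>r = 1..N+1.
      ds N (\<phi> s) i p * ds N (\<phi> s) j q * partial k (\<lambda>t. \<phi> t r) s * GamU N (\<phi> s) p q r
    + ds N (\<phi> s) i p * dds N (\<phi> s) j q r * partial k (\<lambda>t. \<phi> t r) s * gU N (\<phi> s) p q)"

end

theory Submission
  imports Defs
begin

text \<open>Let \<open>S(z) = (\<Prod>i = 1..N. 1 + u i * z) / (1 + u (N + 1) * z)\<close>; its coefficients up to \<open>z ^ N\<close> are
  \<open>1, s 1, \<dots>, s N\<close>, and the later ones are \<open>s N * (- s (N + 1)) ^ a\<close>. Put
  \<open>Y\<^sub>p(z) = u p * z * S(z) / (1 + u p * z)\<close>, and let \<open>\<eta>\<^sub>p\<close> be -1 for \<open>p = N + 1\<close> and 1 otherwise, so that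
  \<open>u p * \<partial>S(z)/\<partial>(u p) = \<eta>\<^sub>p * Y\<^sub>p(z)\<close>. Since
  \<open>mm N p q = 1 + (1 - N) * \<eta>\<^sub>p * \<delta>\<^sub>p\<^sub>q\<close>, Euler's identity \<open>(\<Sum>p. \<eta>\<^sub>p * Y\<^sub>p(z)) = z * S'(z)\<close> and partial
  fractions give, for the components with i, j at most N, the generating functions
  \<open>g / (z w) = S'(z) S'(w) + (1 - N) (S(z) S'(w) - S'(z) S(w)) / (z - w)\<close> and
  \<open>\<Gamma> / (z w) = S'(z) dS'(w) + (1 - N) ((S(z) dS'(w) - S'(z) dS(w)) / (z - w) - (S(w) dS(z) - S(z) dS(w)) / (z - w)\<^sup>2)\<close>.
  The second is linear in S and in dS, and dS does not involve \<open>s (N - 1)\<close>. In the first, the square of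
  \<open>s (N - 1)\<close> occurs only for i = j = N - 1, with coefficient \<open>(N - 1)\<^sup>2 + (1 - N) (N - 1) = 0\<close>.

  The local inverse is differentiable because a nonsingular Jacobian makes \<open>u 1, \<dots>, u N\<close> distinct, so
  that they are, up to sign, simple roots of a polynomial whose coefficients are polynomials in s.\<close>

section \<open>Calculus along curves: chain rule and closure properties\<close>

text \<open>Differentiability stated through the chain rule: points are functions on all of nat, for
  which no norm is available, and only the coordinates 1..N+1 count.\<close>

definition differentiable_along_curves :: "nat \<Rightarrow> ((nat \<Rightarrow> real) \<Rightarrow> real) \<Rightarrow> bool" where
  "differentiable_along_curves N f \<longleftrightarrow> (\<exists>f'. \<forall>c c' t.
     (\<forall>r\<in>{1..N+1}. ((\<lambda>t. c t r) has_real_derivative c' r) (at t)) \<longrightarrow>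
     ((\<lambda>t. f (c t)) has_real_derivative (\<Sum>r = 1..N+1. f' r (c t) * c' r)) (at t))"

text \<open>A coordinate line is a curve whose velocity is a unit vector, so the sum collapses to
  one term. Hence any gradient witnessing \<open>differentiable_along_curves\<close> consists of
  partial derivatives.\<close>

lemma gradient_is_partial:
  fixes N p :: nat
  assumes "\<And>c c' t. (\<And>r. r \<in> {1..N+1} \<Longrightarrow> ((\<lambda>t. c t r) has_real_derivative c' r) (at t)) \<Longrightarrow>
     ((\<lambda>t. f (c t)) has_real_derivative (\<Sum>r = 1..N+1. f' r (c t) * c' r)) (at t)"
    and "p \<in> {1..N+1}"
  shows "((\<lambda>t. f (x(p := t))) has_real_derivative f' p x) (at (x p))"
proof -
  have "((\<lambda>t. f (x(p := t))) has_real_derivative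
      (\<Sum>r = 1..N+1. f' r (x(p := x p)) * (if r = p then 1 else 0))) (at (x p))"
    by (rule assms(1)) auto
  moreover have "(\<Sum>r = 1..N+1. f' r (x(p := x p)) * (if r = p then 1 else 0))
      = (\<Sum>r = 1..N+1. if r = p then f' r x else 0)"
    by (rule sum.cong) auto
  moreover have "\<dots> = f' p x"
    using assms(2) by (subst sum.delta) auto
  ultimately show ?thesis by (simp only: fun_upd_triv)
qed

lemma chain_rule:
  assumes "differentiable_along_curves N f"
    and c: "\<And>r. r \<in> {1..N+1} \<Longrightarrow> ((\<lambda>t. c t r) has_real_derivative c' r) (at t)"
  shows "((\<lambda>t. f (c t)) has_real_derivative (\<Sum>r = 1..N+1. partial r f (c t) * c' r)) (at t)"
proof -
  obtain f' where f': "\<And>c c' t. (\<And>r. r \<in> {1..N+1} \<Longrightarrow> ((\<lambda>t. c t r) has_real_derivative c' r) (at t)) \<Longrightarrow>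
     ((\<lambda>t. f (c t)) has_real_derivative (\<Sum>r = 1..N+1. f' r (c t) * c' r)) (at t)"
    using assms(1) unfolding differentiable_along_curves_def by blast
  have "partial r f (c t) = f' r (c t)" if "r \<in> {1..N+1}" for r
    unfolding partial_def using gradient_is_partial[of N f f' r, OF f' that] DERIV_imp_deriv by blast
  then have "(\<Sum>r = 1..N+1. partial r f (c t) * c' r) = (\<Sum>r = 1..N+1. f' r (c t) * c' r)"
    by (intro sum.cong) auto
  then show ?thesis
    using f'[of c c' t, OF c] by (simp only:)
qed

lemma differentiable_along_curves_const: "differentiable_along_curves N (\<lambda>_. a)"
  unfolding differentiable_along_curves_def by (rule exI[of _ "\<lambda>_ _. 0"]) auto

lemma differentiable_along_curves_coord:
  assumes "q \<in> {1..N+1}"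
  shows "differentiable_along_curves N (\<lambda>x. x q)"
proof -
  have "(\<Sum>r = 1..N+1. (if r = q then 1 else 0) * c' r) = c' q" for c' :: "nat \<Rightarrow> real"
    using assms by (simp add: if_distrib[of "\<lambda>x. x * _"] cong: if_cong)
  then show ?thesis
    unfolding differentiable_along_curves_def using assms
    by (intro exI[of _ "\<lambda>r _. if r = q then 1 else 0"]) simp
qed

lemma differentiable_along_curves_add:
  assumes "differentiable_along_curves N f" "differentiable_along_curves N g"
  shows "differentiable_along_curves N (\<lambda>x. f x + g x)"
  unfolding differentiable_along_curves_def
proof (intro exI[of _ "\<lambda>r x. partial r f x + partial r g x"] allI impI)
  fix c c' t assume "\<forall>r\<in>{1..N+1}. ((\<lambda>t. c t r) has_real_derivative c' r) (at t)"
  then show "((\<lambda>t. f (c t) + g (c t)) has_real_derivative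
      (\<Sum>r = 1..N+1. (partial r f (c t) + partial r g (c t)) * c' r)) (at t)"
    using DERIV_add[OF chain_rule[OF assms(1), of c c' t] chain_rule[OF assms(2), of c c' t]]
    by (simp add: distrib_right sum.distrib)
qed

lemma differentiable_along_curves_mult:
  assumes "differentiable_along_curves N f" "differentiable_along_curves N g"
  shows "differentiable_along_curves N (\<lambda>x. f x * g x)"
  unfolding differentiable_along_curves_def
proof (intro exI[of _ "\<lambda>r x. partial r f x * g x + f x * partial r g x"] allI impI)
  fix c c' t assume *: "\<forall>r\<in>{1..N+1}. ((\<lambda>t. c t r) has_real_derivative c' r) (at t)"
  have "((\<lambda>t. f (c t) * g (c t)) has_real_derivative
      (\<Sum>r = 1..N+1. partial r f (c t) * c' r) * g (c t) + (\<Sum>r = 1..N+1. partial r g (c t) * c' r) * f (c t)) (at t)"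
    by (rule DERIV_mult) (use * chain_rule[OF assms(1)] chain_rule[OF assms(2)] in auto)
  moreover have "(\<Sum>r = 1..N+1. partial r f (c t) * c' r) * g (c t) + (\<Sum>r = 1..N+1. partial r g (c t) * c' r) * f (c t)
    = (\<Sum>r = 1..N+1. (partial r f (c t) * g (c t) + f (c t) * partial r g (c t)) * c' r)"
    unfolding sum_distrib_right sum.distrib[symmetric] by (rule sum.cong) (auto simp: algebra_simps)
  ultimately show "((\<lambda>t. f (c t) * g (c t)) has_real_derivative
      (\<Sum>r = 1..N+1. (partial r f (c t) * g (c t) + f (c t) * partial r g (c t)) * c' r)) (at t)"
    by simp
qed

lemma differentiable_along_curves_diff:
  assumes "differentiable_along_curves N f" "differentiable_along_curves N g"
  shows "differentiable_along_curves N (\<lambda>x. f x - g x)"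
  using differentiable_along_curves_add[OF assms(1)
      differentiable_along_curves_mult[OF differentiable_along_curves_const[of N "-1"] assms(2)]]
  by simp

lemma differentiable_along_curves_sum:
  assumes "\<And>a. a \<in> A \<Longrightarrow> differentiable_along_curves N (f a)"
  shows "differentiable_along_curves N (\<lambda>x. \<Sum>a\<in>A. f a x)"
  using assms
  by (induction A rule: infinite_finite_induct)
     (auto intro: differentiable_along_curves_const differentiable_along_curves_add)

lemma differentiable_along_curves_prod:
  assumes "\<And>a. a \<in> A \<Longrightarrow> differentiable_along_curves N (f a)"
  shows "differentiable_along_curves N (\<lambda>x. \<Prod>a\<in>A. f a x)"
  using assms
  by (induction A rule: infinite_finite_induct)
     (auto intro: differentiable_along_curves_const differentiable_along_curves_mult)

lemmas differentiable_along_curves_intros =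
  differentiable_along_curves_const differentiable_along_curves_coord
  differentiable_along_curves_add differentiable_along_curves_diff differentiable_along_curves_mult
  differentiable_along_curves_sum differentiable_along_curves_prod

section \<open>Elementary symmetric polynomials\<close>

lemma esym_0: "esym N u 0 = 1"
proof -
  have "{S. S \<subseteq> {1..N} \<and> card S = 0} = {{}}"
    using finite_subset[of _ "{1..N}"] by auto
  then show ?thesis by (simp add: esym_def)
qed

lemma esym_gt:
  assumes "r > N"
  shows "esym N u r = 0"
proof -
  have "card S \<le> N" if "S \<subseteq> {1..N}" for S
    using card_mono[OF _ that] by simp
  then have "{S. S \<subseteq> {1..N} \<and> card S = r} = {}"
    using assms by (metis (mono_tags, lifting) empty_Collect_eq not_le)
  then show ?thesis by (simp only: esym_def sum.empty)
qed

lemma esym_cong: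
  assumes "\<And>i. i \<in> {1..N} \<Longrightarrow> u i = v i"
  shows "esym N u r = esym N v r"
  unfolding esym_def using assms by (intro sum.cong prod.cong) auto

lemma esym_scale: "esym N (\<lambda>i. t * u i) r = t ^ r * esym N u r"
  unfolding esym_def sum_distrib_left by (rule sum.cong) (auto simp: prod.distrib)

text \<open>Subsets are sorted by whether they contain \<open>p\<close>. Putting zero at
  \<open>p\<close> kills the products through \<open>p\<close>, so \<open>u(p := 0)\<close> encodes
  the symmetric polynomials of the remaining variables.\<close>

lemma esym_update:
  assumes "p \<in> {1..N}"
  shows "esym N (u(p := t)) (Suc r) = esym N (u(p := 0)) (Suc r) + t * esym N (u(p := 0)) r"
proof -
  define P where "P r = {S. S \<subseteq> {1..N} - {p} \<and> card S = r}" for r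
  have fin: "finite S" if "S \<subseteq> {1..N}" for S
    using that finite_subset by blast
  have finP: "finite (P r)" for r
    unfolding P_def by (rule finite_subset[of _ "Pow {1..N}"]) auto
  have split: "{S. S \<subseteq> {1..N} \<and> card S = Suc r} = P (Suc r) \<union> insert p ` P r"
  proof (intro set_eqI iffI)
    fix S assume S: "S \<in> {S. S \<subseteq> {1..N} \<and> card S = Suc r}"
    show "S \<in> P (Suc r) \<union> insert p ` P r"
    proof (cases "p \<in> S")
      case True
      then have "S = insert p (S - {p})" "S - {p} \<in> P r"
        using S fin[of S] by (auto simp: P_def)
      then show ?thesis by blast
    qed (use S in \<open>auto simp: P_def\<close>)
  next
    fix S assume "S \<in> P (Suc r) \<union> insert p ` P r"
    then show "S \<in> {S. S \<subseteq> {1..N} \<and> card S = Suc r}"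
    proof
      assume "S \<in> insert p ` P r"
      then obtain R where R: "S = insert p R" "R \<subseteq> {1..N} - {p}" "card R = r"
        by (auto simp: P_def)
      then have "finite R" "p \<notin> R" using fin[of R] by auto
      then show ?thesis using R assms by auto
    qed (auto simp: P_def)
  qed
  have inj: "inj_on (insert p) (P r)" for r
    by (rule inj_onI) (auto simp: P_def insert_ident)
  have e: "esym N (u(p := x)) (Suc r) = (\<Sum>S\<in>P (Suc r). \<Prod>i\<in>S. u i) + x * (\<Sum>S\<in>P r. \<Prod>i\<in>S. u i)" for x
  proof -
    have "esym N (u(p := x)) (Suc r) = (\<Sum>S\<in>P (Suc r). \<Prod>i\<in>S. (u(p := x)) i)
        + (\<Sum>S\<in>insert p ` P r. \<Prod>i\<in>S. (u(p := x)) i)"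
      unfolding esym_def split
      by (rule sum.union_disjoint) (use finP in \<open>auto simp: P_def\<close>)
    also have "(\<Sum>S\<in>P (Suc r). \<Prod>i\<in>S. (u(p := x)) i) = (\<Sum>S\<in>P (Suc r). \<Prod>i\<in>S. u i)"
      by (intro sum.cong prod.cong) (auto simp: P_def)
    also have "(\<Sum>S\<in>insert p ` P r. \<Prod>i\<in>S. (u(p := x)) i) = (\<Sum>S\<in>P r. \<Prod>i\<in>insert p S. (u(p := x)) i)"
      using sum.reindex[OF inj[of r]] by simp
    also have "\<dots> = x * (\<Sum>S\<in>P r. \<Prod>i\<in>S. u i)"
      unfolding sum_distrib_left
    proof (rule sum.cong[OF refl])
      fix S assume "S \<in> P r"
      then have S: "finite S" "p \<notin> S" using fin[of S] by (auto simp: P_def)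
      then have "(\<Prod>i\<in>S. (u(p := x)) i) = (\<Prod>i\<in>S. u i)"
        by (intro prod.cong) auto
      then show "(\<Prod>i\<in>insert p S. (u(p := x)) i) = x * (\<Prod>i\<in>S. u i)"
        using S by simp
    qed
    finally show ?thesis .
  qed
  have "esym N (u(p := 0)) r = (\<Sum>S\<in>P r. \<Prod>i\<in>S. u i)"
  proof -
    have "(\<Prod>i\<in>S. (u(p := 0)) i) = 0" if "S \<subseteq> {1..N}" "p \<in> S" for S
      using that fin[of S] by (auto simp: prod_zero_iff intro!: bexI[of _ p])
    then have "esym N (u(p := 0)) r = (\<Sum>S\<in>P r. \<Prod>i\<in>S. (u(p := 0)) i)"
      unfolding esym_def by (intro sum.mono_neutral_right) (auto simp: P_def)
    also have "\<dots> = (\<Sum>S\<in>P r. \<Prod>i\<in>S. u i)"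
      by (intro sum.cong prod.cong) (auto simp: P_def)
    finally show ?thesis .
  qed
  then show ?thesis using e[of t] e[of 0] by simp
qed

text \<open>Vieta: the product is expanded over subsets, grouped by size. It makes each
  \<open>- u i\<close> a root of a polynomial with coefficients \<open>esym\<close>.\<close>

lemma prod_add_esym: "(\<Prod>i = 1..N. x + u i) = (\<Sum>r = 0..N. esym N u r * x ^ (N - r))"
proof -
  have "(\<Prod>i = 1..N. u i + x) = (\<Sum>S\<in>Pow {1..N}. (\<Prod>i\<in>S. u i) * (\<Prod>i\<in>{1..N} - S. x))"
    by (rule prod_add) simp
  also have "\<dots> = (\<Sum>S\<in>Pow {1..N}. (\<Prod>i\<in>S. u i) * x ^ (N - card S))"
    by (intro sum.cong) (auto simp: card_Diff_subset finite_subset)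
  also have "\<dots> = (\<Sum>r = 0..N. \<Sum>S | S \<in> Pow {1..N} \<and> card S = r. (\<Prod>i\<in>S. u i) * x ^ (N - card S))"
    by (rule sum.group[symmetric]) (auto dest: card_mono[rotated])
  also have "\<dots> = (\<Sum>r = 0..N. esym N u r * x ^ (N - r))"
    unfolding esym_def sum_distrib_right by (intro sum.cong) auto
  finally show ?thesis by (simp add: add.commute)
qed

lemma differentiable_along_curves_esym: "differentiable_along_curves N (\<lambda>u. esym N u r)"
  unfolding esym_def by (intro differentiable_along_curves_intros) auto

section \<open>Coefficients of the Lax series and their derivatives in u\<close>

text \<open>\<open>lcoef N u r\<close> is the coefficient of \<open>z ^ r\<close> in
  \<open>S(z) = (\<Prod>i = 1..N. 1 + u i * z) / (1 + u (N + 1) * z)\<close> (for all r, not only r at most N);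
  \<open>tcoef N u p r\<close> and \<open>ycoef N u p r\<close> are those of \<open>S(z) / (1 + u p * z)\<close> and of
  \<open>u p * z * S(z) / (1 + u p * z)\<close>.\<close>

fun lcoef :: "nat \<Rightarrow> (nat \<Rightarrow> real) \<Rightarrow> nat \<Rightarrow> real" where
  "lcoef N u 0 = 1"
| "lcoef N u (Suc r) = esym N u (Suc r) - u (N + 1) * lcoef N u r"

fun tcoef :: "nat \<Rightarrow> (nat \<Rightarrow> real) \<Rightarrow> nat \<Rightarrow> nat \<Rightarrow> real" where
  "tcoef N u p 0 = 1"
| "tcoef N u p (Suc r) = lcoef N u (Suc r) - u p * tcoef N u p r"

definition ycoef :: "nat \<Rightarrow> (nat \<Rightarrow> real) \<Rightarrow> nat \<Rightarrow> nat \<Rightarrow> real" where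
  "ycoef N u p r = (case r of 0 \<Rightarrow> 0 | Suc r \<Rightarrow> u p * tcoef N u p r)"

text \<open>The exponent with which the factor \<open>1 + u p * z\<close> occurs in S(z).\<close>

definition eta :: "nat \<Rightarrow> nat \<Rightarrow> real" where
  "eta N p = (if p = N + 1 then -1 else 1)"

lemma ycoef_0 [simp]: "ycoef N u p 0 = 0"
  and ycoef_Suc [simp]: "ycoef N u p (Suc r) = u p * tcoef N u p r"
  by (simp_all add: ycoef_def)

text \<open>Partial fractions: 1/(1 + uz) = 1 - uz/(1 + uz).\<close>

lemma tcoef_eq: "tcoef N u p r = lcoef N u r - ycoef N u p r"
  by (cases r) auto

lemma lcoef_eq_sum: "lcoef N u r = (\<Sum>n = 0..r. (-1) ^ n * esym N u (r - n) * u (N + 1) ^ n)"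
proof (induction r)
  case (Suc r)
  have "(\<Sum>n = 0..Suc r. (-1) ^ n * esym N u (Suc r - n) * u (N + 1) ^ n)
     = esym N u (Suc r) + (\<Sum>n = 0..r. (-1) ^ Suc n * esym N u (r - n) * u (N + 1) ^ Suc n)"
    by (subst sum.atLeast0_atMost_Suc_shift) simp
  also have "(\<Sum>n = 0..r. (-1) ^ Suc n * esym N u (r - n) * u (N + 1) ^ Suc n) = - u (N + 1) * lcoef N u r"
    unfolding Suc.IH sum_distrib_left by (rule sum.cong) auto
  finally show ?case by simp
qed (simp add: esym_0)

lemma sfun_eq_lcoef: "r \<in> {1..N} \<Longrightarrow> sfun N u r = lcoef N u r"
  by (simp add: sfun_def lcoef_eq_sum)

text \<open>\<open>esym\<close> vanishes beyond degree N, so the recursion for \<open>lcoef\<close>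
  becomes homogeneous there.\<close>

lemma lcoef_tail: "lcoef N u (N + a) = (- u (N + 1)) ^ a * lcoef N u N"
  by (induction a) (auto simp: esym_gt)

lemma lcoef_scale: "lcoef N (\<lambda>i. t * u i) r = t ^ r * lcoef N u r"
  by (induction r) (auto simp: esym_scale algebra_simps)

lemma differentiable_along_curves_lcoef: "differentiable_along_curves N (\<lambda>u. lcoef N u r)"
  by (induction r) (auto intro!: differentiable_along_curves_intros differentiable_along_curves_esym)

lemma differentiable_along_curves_tcoef:
  assumes "p \<in> {1..N+1}"
  shows "differentiable_along_curves N (\<lambda>u. tcoef N u p r)"
proof (induction r)
  case (Suc r)
  then show ?case
    unfolding tcoef.simps using assms
    by (intro differentiable_along_curves_diff differentiable_along_curves_mult
        differentiable_along_curves_coord differentiable_along_curves_lcoef)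
qed (simp add: differentiable_along_curves_const)

lemma differentiable_along_curves_ycoef:
  assumes "p \<in> {1..N+1}"
  shows "differentiable_along_curves N (\<lambda>u. ycoef N u p r)"
  using assms by (cases r) (auto intro!: differentiable_along_curves_intros differentiable_along_curves_tcoef)

text \<open>S(z) contains \<open>u p\<close> only in its numerator factor
  \<open>1 + u p * z\<close>. The recursion for \<open>lcoef\<close> carries
  \<open>esym_update\<close> over to the quotient.\<close>

lemma lcoef_update:
  assumes "p \<in> {1..N}"
  shows "lcoef N (u(p := t)) (Suc r) = lcoef N (u(p := 0)) (Suc r) + t * lcoef N (u(p := 0)) r"
proof (induction r)
  case 0
  then show ?case
    using esym_update[OF assms, of u t 0] assms by (simp add: esym_0 del: fun_upd_apply) (simp add: fun_upd_def)
next
  case (Suc r)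
  have "lcoef N (u(p := t)) (Suc (Suc r)) = esym N (u(p := t)) (Suc (Suc r)) - u (N + 1) * lcoef N (u(p := t)) (Suc r)"
    using assms by (subst lcoef.simps(2)) simp
  also have "\<dots> = esym N (u(p := 0)) (Suc (Suc r)) - u (N + 1) * lcoef N (u(p := 0)) (Suc r)
      + t * (esym N (u(p := 0)) (Suc r) - u (N + 1) * lcoef N (u(p := 0)) r)"
    unfolding Suc esym_update[OF assms, of u t] by (simp only: algebra_simps)
  also have "\<dots> = lcoef N (u(p := 0)) (Suc (Suc r)) + t * lcoef N (u(p := 0)) (Suc r)"
    using assms by simp
  finally show ?case .
qed

text \<open>Dividing S(z) by its numerator factor \<open>1 + u p * z\<close> removes that factor,
  just as setting \<open>u p\<close> to zero does.\<close>

lemma tcoef_eq_lcoef: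
  assumes "p \<in> {1..N}"
  shows "tcoef N u p r = lcoef N (u(p := 0)) r"
proof (induction r)
  case (Suc r)
  have "lcoef N u (Suc r) = lcoef N (u(p := 0)) (Suc r) + u p * lcoef N (u(p := 0)) r"
    using lcoef_update[OF assms, of u "u p" r] by (simp only: fun_upd_triv)
  then show ?case
    by (simp only: tcoef.simps Suc)
qed simp

text \<open>The derivative of 1/(1 + tz) in t is -z/(1 + tz)^2, so S(z) is divided by its
  denominator once more. The symmetric polynomials do not involve the coordinate N + 1, and the
  recursion can be differentiated step by step.\<close>

lemma lcoef_has_pole_derivative:
  "((\<lambda>t. lcoef N (u(N + 1 := t)) (Suc r)) has_real_derivative - tcoef N (u(N + 1 := t)) (N + 1) r) (at t)"
proof (induction r)
  case 0
  have "esym N (u(N + 1 := t)) = esym N u" for t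
    by (intro ext esym_cong) auto
  then show ?case by (auto intro!: derivative_eq_intros simp del: fun_upd_apply simp: fun_upd_same)
next
  case (Suc r)
  have e: "esym N (u(N + 1 := t)) = esym N u" for t
    by (intro ext esym_cong) auto
  have "((\<lambda>t. esym N u (Suc (Suc r)) - t * lcoef N (u(N + 1 := t)) (Suc r)) has_real_derivative
     - (lcoef N (u(N + 1 := t)) (Suc r) + t * - tcoef N (u(N + 1 := t)) (N + 1) r)) (at t)"
    using DERIV_diff[OF DERIV_const[of "esym N u (Suc (Suc r))"] DERIV_mult[OF DERIV_ident Suc]]
    by (simp add: algebra_simps del: lcoef.simps fun_upd_apply)
  moreover have "lcoef N (u(N + 1 := t)) (Suc (Suc r))
      = esym N u (Suc (Suc r)) - t * lcoef N (u(N + 1 := t)) (Suc r)" for t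
    by (subst lcoef.simps(2)) (simp only: e fun_upd_same)
  ultimately show ?case by (simp del: lcoef.simps fun_upd_apply add: fun_upd_same)
qed

lemma partial_lcoef:
  assumes "p \<in> {1..N+1}"
  shows "partial p (\<lambda>u. lcoef N u (Suc r)) u = eta N p * tcoef N u p r"
proof (cases "p = N + 1")
  case True
  then show ?thesis
    using DERIV_imp_deriv[OF lcoef_has_pole_derivative[of N u r "u (N + 1)"]]
    by (simp add: partial_def eta_def del: lcoef.simps)
next
  case False
  with assms have p: "p \<in> {1..N}" by auto
  have "((\<lambda>t. lcoef N (u(p := t)) (Suc r)) has_real_derivative lcoef N (u(p := 0)) r) (at (u p))"
    by (subst lcoef_update[OF p, of u _ r]) (auto intro!: derivative_eq_intros simp del: lcoef.simps)
  then show ?thesis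
    using False tcoef_eq_lcoef[OF p] by (simp add: partial_def eta_def DERIV_imp_deriv del: lcoef.simps)
qed

text \<open>\<open>lcoef N u r\<close> is homogeneous of degree r. Its derivative along the ray
  through \<open>u\<close>, at parameter 1, is computed by the chain rule and by
  \<open>lcoef_scale\<close>.\<close>

lemma euler_lcoef: "(\<Sum>p = 1..N+1. eta N p * ycoef N u p r) = real r * lcoef N u r"
proof (cases r)
  case (Suc m)
  have "((\<lambda>t. lcoef N (\<lambda>i. t * u i) r) has_real_derivative
      (\<Sum>p = 1..N+1. partial p (\<lambda>u. lcoef N u r) (\<lambda>i. 1 * u i) * u p)) (at 1)"
    by (rule chain_rule[OF differentiable_along_curves_lcoef, of N "\<lambda>t i. t * u i" u 1])
       (auto intro!: derivative_eq_intros)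
  moreover have "((\<lambda>t. lcoef N (\<lambda>i. t * u i) r) has_real_derivative real r * lcoef N u r) (at 1)"
    unfolding lcoef_scale by (auto intro!: derivative_eq_intros)
  ultimately have "(\<Sum>p = 1..N+1. partial p (\<lambda>u. lcoef N u r) (\<lambda>i. 1 * u i) * u p) = real r * lcoef N u r"
    by (rule DERIV_unique)
  moreover have "(\<Sum>p = 1..N+1. partial p (\<lambda>u. lcoef N u r) (\<lambda>i. 1 * u i) * u p)
      = (\<Sum>p = 1..N+1. eta N p * ycoef N u p r)"
    by (rule sum.cong[OF refl]) (simp add: Suc partial_lcoef del: lcoef.simps)
  ultimately show ?thesis by simp
qed simp

section \<open>The Jacobian of s with respect to u\<close>

lemma ds_eq:
  assumes "i \<in> {1..N}" "p \<in> {1..N+1}"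
  shows "ds N u i p = eta N p * tcoef N u p (i - 1)"
proof -
  obtain r where r: "i = Suc r" using assms(1) by (cases i) auto
  have "(\<lambda>v. sfun N v i) = (\<lambda>v. lcoef N v (Suc r))"
    using assms(1) r sfun_eq_lcoef[of i N] by fastforce
  then show ?thesis
    using partial_lcoef[OF assms(2), of r u] r by (simp add: ds_def del: lcoef.simps)
qed

lemma ds_last: "ds N u (N + 1) p = (if p = N + 1 then 1 else 0)"
  by (auto simp: ds_def partial_def sfun_def)

lemma differentiable_along_curves_ds:
  assumes "i \<in> {1..N+1}" "p \<in> {1..N+1}"
  shows "differentiable_along_curves N (\<lambda>u. ds N u i p)"
proof (cases "i = N + 1")
  case True
  then show ?thesis by (simp add: ds_last[simplified] differentiable_along_curves_const)
next
  case False
  then have "(\<lambda>u. ds N u i p) = (\<lambda>u. eta N p * tcoef N u p (i - 1))"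
    using assms ds_eq[of i N p] by fastforce
  then show ?thesis
    using assms(2) differentiable_along_curves_mult[OF differentiable_along_curves_const
        differentiable_along_curves_tcoef] by auto
qed

text \<open>\<open>tcoef\<close> depends on \<open>p\<close> only through \<open>u p\<close>, so two
  equal coordinates give two equal Jacobian columns. The difference of the two unit vectors then
  lies in the kernel.\<close>

lemma inj_on_if_jac_nonsing:
  assumes "jac_nonsing N u"
  shows "inj_on u {1..N}"
proof (rule inj_onI, rule ccontr)
  fix a b assume ab: "a \<in> {1..N}" "b \<in> {1..N}" "u a = u b" "a \<noteq> b"
  define w :: "nat \<Rightarrow> real" where "w p = (if p = a then 1 else 0) - (if p = b then 1 else 0)" for p
  have t: "tcoef N u a r = tcoef N u b r" for r
    by (induction r) (use ab in auto)
  have "ds N u i a = ds N u i b" if "i \<in> {1..N+1}" for i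
  proof (cases "i = N + 1")
    case False
    then show ?thesis
      using that ab t ds_eq[of i N a u] ds_eq[of i N b u] by (simp add: eta_def)
  qed (use ab ds_last[of N u] in simp)
  moreover have "(\<Sum>p = 1..N+1. ds N u i p * w p) = ds N u i a - ds N u i b" for i
  proof -
    have "(\<Sum>p = 1..N+1. ds N u i p * w p)
        = (\<Sum>p = 1..N+1. if p = a then ds N u i p else 0) - (\<Sum>p = 1..N+1. if p = b then ds N u i p else 0)"
      unfolding sum_subtractf[symmetric] by (rule sum.cong) (auto simp: w_def)
    then show ?thesis
      using ab by (simp only: sum.delta finite_atLeastAtMost) auto
  qed
  ultimately have "\<forall>i\<in>{1..N+1}. (\<Sum>p = 1..N+1. ds N u i p * w p) = 0"
    by simp
  then have "\<forall>p\<in>{1..N+1}. w p = 0"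
    using assms unfolding jac_nonsing_def by blast
  then have "w a = 0" using ab(1) by simp
  then show False using ab(4) by (simp add: w_def)
qed

section \<open>Differentiability of the local inverse\<close>

text \<open>Implicit differentiation of a continuous branch. The polynomial at t minus that at t0,
  both evaluated at \<open>x t\<close>, equals \<open>- (x t - x t0) * q (x t)\<close>. The root is
  simple, so one may divide by \<open>q (x t)\<close> near t0 and obtain the difference quotient of
  \<open>x\<close>.\<close>

lemma simple_root_has_derivative:
  fixes x :: "real \<Rightarrow> real" and a :: "nat \<Rightarrow> real \<Rightarrow> real"
  assumes x: "isCont x t0"
    and a: "\<And>r. r \<le> N \<Longrightarrow> (a r has_real_derivative a' r) (at t0)"
    and root: "eventually (\<lambda>t. (\<Sum>r = 0..N. a r t * x t ^ (N - r)) = 0) (at t0)"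
    and factor: "\<And>y. (\<Sum>r = 0..N. a r t0 * y ^ (N - r)) = (y - x t0) * q y"
    and q: "isCont q (x t0)" "q (x t0) \<noteq> 0"
  shows "(x has_real_derivative - (\<Sum>r = 0..N. a' r * x t0 ^ (N - r)) / q (x t0)) (at t0)"
proof -
  have xt: "(x \<longlongrightarrow> x t0) (at t0)" using x by (simp add: isCont_def)
  have qt: "((\<lambda>t. q (x t)) \<longlongrightarrow> q (x t0)) (at t0)"
    using isCont_tendsto_compose[OF q(1) xt] .
  have "((\<lambda>t. - (\<Sum>r = 0..N. (a r t - a r t0) / (t - t0) * x t ^ (N - r)) / q (x t)) \<longlongrightarrow>
      - (\<Sum>r = 0..N. a' r * x t0 ^ (N - r)) / q (x t0)) (at t0)"
    using a by (intro tendsto_intros xt qt q(2)) (auto simp: has_field_derivative_iff)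
  moreover have "eventually (\<lambda>t. - (\<Sum>r = 0..N. (a r t - a r t0) / (t - t0) * x t ^ (N - r)) / q (x t)
      = (x t - x t0) / (t - t0)) (at t0)"
    using root tendsto_imp_eventually_ne[OF qt q(2)] eventually_neq_at_within[of t0]
  proof eventually_elim
    case (elim t)
    have "(\<Sum>r = 0..N. (a r t - a r t0) / (t - t0) * x t ^ (N - r))
        = ((\<Sum>r = 0..N. a r t * x t ^ (N - r)) - (\<Sum>r = 0..N. a r t0 * x t ^ (N - r))) / (t - t0)"
      unfolding sum_subtractf[symmetric] sum_divide_distrib
      by (rule sum.cong) (auto simp: algebra_simps diff_divide_distrib)
    also have "\<dots> = - ((x t - x t0) * q (x t)) / (t - t0)"
      using elim factor[of "x t"] by simp
    finally show ?case using elim by simp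
  qed
  ultimately show ?thesis
    unfolding has_field_derivative_iff by (rule Lim_transform_eventually)
qed

text \<open>\<open>sser N s r\<close> expresses \<open>lcoef\<close> through the coordinates s: beyond r = N the series is
  geometric, with ratio \<open>- s (N + 1)\<close>; \<open>dser N k s r\<close> is its derivative in the direction k.\<close>

definition sser :: "nat \<Rightarrow> (nat \<Rightarrow> real) \<Rightarrow> nat \<Rightarrow> real" where
  "sser N s r = (if r = 0 then 1 else if r \<le> N then s r else (- s (N + 1)) ^ (r - N) * s N)"

definition dser :: "nat \<Rightarrow> nat \<Rightarrow> (nat \<Rightarrow> real) \<Rightarrow> nat \<Rightarrow> real" where
  "dser N k s r = (if r = 0 then 0 else if r \<le> N then (if r = k then 1 else 0)
     else if k = N then (- s (N + 1)) ^ (r - N)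
     else if k = N + 1 then - (real (r - N) * (- s (N + 1)) ^ (r - N - 1) * s N) else 0)"

lemma coord_has_derivative:
  "((\<lambda>t. (s(k := t)) r) has_real_derivative (if r = k then 1 else 0)) (at x)"
  by (auto simp: fun_upd_def)

lemma sser_has_derivative:
  "((\<lambda>t. sser N (s(k := t)) r) has_real_derivative dser N k s r) (at (s k))"
proof -
  have "((\<lambda>t. (- (s(k := t)) (N + 1)) ^ (r - N) * (s(k := t)) N) has_real_derivative
     (real (r - N) * (- s (N + 1)) ^ (r - N - 1) * - (if N + 1 = k then 1 else 0)) * s N
       + (if N = k then 1 else 0) * (- s (N + 1)) ^ (r - N)) (at (s k))"
    using DERIV_mult[OF DERIV_power[OF DERIV_minus[OF coord_has_derivative[of s k "N + 1" "s k"]], of "r - N"]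
        coord_has_derivative[of s k N "s k"]]
    by (simp only: fun_upd_triv) (simp add: algebra_simps)
  then show ?thesis
    using coord_has_derivative[of s k r "s k"] unfolding sser_def dser_def
    by (cases "r = 0"; cases "r \<le> N") (auto split: if_splits)
qed

text \<open>A continuous section, over an open set, of the map from u to s. Its differentiability is
  a consequence, obtained in \<open>phi_has_partial\<close>.\<close>

locale local_inverse =
  fixes N :: nat and V :: "(nat \<Rightarrow> real) set" and \<phi> :: "(nat \<Rightarrow> real) \<Rightarrow> (nat \<Rightarrow> real)"
  assumes N_ge_2: "N \<ge> 2"
    and open_V: "open V"
    and continuous_phi: "continuous_on V \<phi>"
    and sfun_phi: "\<And>s r. s \<in> V \<Longrightarrow> r \<in> {1..N+1} \<Longrightarrow> sfun N (\<phi> s) r = s r"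
    and jac_phi: "\<And>s. s \<in> V \<Longrightarrow> jac_nonsing N (\<phi> s)"
begin

lemma continuous_line: "continuous_on A (\<lambda>t. s(k := t :: real))"
proof (rule continuous_on_coordinatewise_then_product)
  show "continuous_on A (\<lambda>t. (s(k := t)) i)" for i
    by (cases "i = k") auto
qed

lemma open_line: "open {t. s(k := t) \<in> V}"
  using open_vimage[OF open_V continuous_line] by (simp add: vimage_def)

lemma eventually_line:
  assumes "s \<in> V" "\<And>t. s(k := t) \<in> V \<Longrightarrow> P t"
  shows "eventually P (nhds (s k))"
  unfolding eventually_nhds using open_line[of s k] assms
  by (intro exI[of _ "{t. s(k := t) \<in> V}"]) auto

lemma has_derivative_line_cong:
  assumes "((\<lambda>t. g (s(k := t))) has_real_derivative D) (at (s k))" "s \<in> V"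
    and "\<And>s'. s' \<in> V \<Longrightarrow> f s' = g s'"
  shows "((\<lambda>t. f (s(k := t))) has_real_derivative D) (at (s k))"
  by (rule has_field_derivative_transform_within_open[OF assms(1) open_line[of s k]]) (use assms in auto)

lemma isCont_phi:
  assumes "s \<in> V"
  shows "isCont (\<lambda>t. \<phi> (s(k := t)) r) (s k)"
proof -
  have "continuous_on {t. s(k := t) \<in> V} (\<lambda>t. \<phi> (s(k := t)))"
    by (rule continuous_on_compose2[OF continuous_phi continuous_line]) auto
  then have "continuous_on {t. s(k := t) \<in> V} (\<lambda>t. \<phi> (s(k := t)) r)"
    by (rule continuous_on_product_then_coordinatewise)
  then show ?thesis
    using open_line[of s k] assms by (simp add: continuous_on_eq_continuous_at)
qed

lemma phi_last: "s \<in> V \<Longrightarrow> \<phi> s (N + 1) = s (N + 1)"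
  using sfun_phi[of s "N + 1"] by (simp add: sfun_def)

text \<open>The whole series S(z), including its tail, is an explicit function of s. This is how u
  disappears from the final formulas.\<close>

lemma lcoef_phi:
  assumes "s \<in> V"
  shows "lcoef N (\<phi> s) r = sser N s r"
proof -
  have le: "lcoef N (\<phi> s) r = s r" if "1 \<le> r" "r \<le> N" for r
    using sfun_phi[OF assms, of r] sfun_eq_lcoef[of r N "\<phi> s"] that by simp
  have "lcoef N (\<phi> s) r = (- s (N + 1)) ^ (r - N) * s N" if "r > N"
    using lcoef_tail[of N "\<phi> s" "r - N"] phi_last[OF assms] le[of N] N_ge_2 that by simp
  then show ?thesis
    using le[of r] by (auto simp: sser_def)
qed

text \<open>Multiplying S(z) by \<open>1 + s (N + 1) * z\<close> recovers the numerator. The case r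
  = 0 is separate because \<open>r - 1\<close> would be 0 again.\<close>

lemma esym_phi:
  assumes "s \<in> V"
  shows "esym N (\<phi> s) r = (if r = 0 then 1 else sser N s r + s (N + 1) * sser N s (r - 1))"
proof (cases r)
  case (Suc m)
  then show ?thesis
    using lcoef_phi[OF assms, of r] lcoef_phi[OF assms, of m] phi_last[OF assms] by simp
qed (simp add: esym_0)

text \<open>The last coordinate of \<open>\<phi> s\<close> is \<open>s (N + 1)\<close>. For any
  other, \<open>- \<phi> s p\<close> is a simple root of a polynomial whose coefficients are
  differentiable in \<open>s k\<close>.\<close>

lemma phi_has_partial:
  assumes "s \<in> V" "p \<in> {1..N+1}"
  shows "((\<lambda>t. \<phi> (s(k := t)) p) has_real_derivative partial k (\<lambda>s. \<phi> s p) s) (at (s k))"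
proof -
  have "\<exists>D. ((\<lambda>t. \<phi> (s(k := t)) p) has_real_derivative D) (at (s k))"
  proof (cases "p = N + 1")
    case True
    show ?thesis
      unfolding True
      using has_derivative_line_cong[where f = "\<lambda>s. \<phi> s (N + 1)" and k = k,
          OF coord_has_derivative assms(1) phi_last] by blast
  next
    case False
    define x where "x t = - \<phi> (s(k := t)) p" for t
    define e where "e r t = (if r = 0 then 1 else sser N (s(k := t)) r + (s(k := t)) (N + 1) * sser N (s(k := t)) (r - 1))" for r t
    define e' where "e' r = (if r = 0 then 0 else dser N k s r + ((if N + 1 = k then 1 else 0) * sser N s (r - 1) + dser N k s (r - 1) * s (N + 1)))" for r
    define q where "q y = (\<Prod>j\<in>{1..N} - {p}. y + \<phi> s j)" for y
    have p: "p \<in> {1..N}" using assms(2) False by auto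
    have prod: "(\<Sum>r = 0..N. e r t * y ^ (N - r)) = (\<Prod>i = 1..N. y + \<phi> (s(k := t)) i)"
      if "s(k := t) \<in> V" for t y
      unfolding prod_add_esym esym_phi[OF that] e_def ..
    have "(x has_real_derivative - (\<Sum>r = 0..N. e' r * x (s k) ^ (N - r)) / q (x (s k))) (at (s k))"
    proof (rule simple_root_has_derivative[where a = e])
      show "isCont x (s k)"
        unfolding x_def by (intro continuous_intros isCont_phi assms)
      show "(e r has_real_derivative e' r) (at (s k))" for r
      proof (cases "r = 0")
        case False
        have "((\<lambda>t. sser N (s(k := t)) r + (s(k := t)) (N + 1) * sser N (s(k := t)) (r - 1)) has_real_derivative
            dser N k s r + ((if N + 1 = k then 1 else 0) * sser N (s(k := s k)) (r - 1) + dser N k s (r - 1) * (s(k := s k)) (N + 1))) (at (s k))"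
          by (intro DERIV_add DERIV_mult sser_has_derivative coord_has_derivative)
        then show ?thesis using False unfolding e_def e'_def by simp
      qed (simp add: e_def[abs_def] e'_def)
      have "(\<Prod>i = 1..N. x t + \<phi> (s(k := t)) i) = 0" for t
        using p by (auto simp: x_def prod_zero_iff)
      then have "eventually (\<lambda>t. (\<Sum>r = 0..N. e r t * x t ^ (N - r)) = 0) (nhds (s k))"
        by (intro eventually_line[OF assms(1)]) (simp add: prod)
      then show "eventually (\<lambda>t. (\<Sum>r = 0..N. e r t * x t ^ (N - r)) = 0) (at (s k))"
        by (simp add: eventually_nhds_conv_at)
      show "(\<Sum>r = 0..N. e r (s k) * y ^ (N - r)) = (y - x (s k)) * q y" for y
        using prod[of "s k" y] assms(1) p by (simp add: x_def q_def prod.remove[of _ p])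
      show "isCont q (x (s k))"
        unfolding q_def by (intro continuous_intros)
      \<comment> \<open>At the root the other factors are the differences
        \<open>\<phi> s j - \<phi> s p\<close>.\<close>
      have "x (s k) + \<phi> s j \<noteq> 0" if "j \<in> {1..N} - {p}" for j
        using inj_on_contraD[OF inj_on_if_jac_nonsing[OF jac_phi[OF assms(1)]], of p j] that p
        by (simp add: x_def)
      then show "q (x (s k)) \<noteq> 0"
        unfolding q_def by (simp add: prod_zero_iff)
    qed
    from DERIV_minus[OF this] show ?thesis
      by (auto simp: x_def)
  qed
  then show ?thesis
    unfolding partial_def using DERIV_imp_deriv by force
qed

section \<open>Derivatives in s of functions of u\<close>

text \<open>The operator d of the overview, in the direction of \<open>s k\<close>, acting on
  functions of u pulled back by \<open>\<phi>\<close>.\<close>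

definition dot :: "nat \<Rightarrow> ((nat \<Rightarrow> real) \<Rightarrow> real) \<Rightarrow> (nat \<Rightarrow> real) \<Rightarrow> real" where
  "dot k f s = partial k (\<lambda>s. f (\<phi> s)) s"

lemma has_dot_sum:
  assumes "differentiable_along_curves N f" "s \<in> V"
  shows "((\<lambda>t. f (\<phi> (s(k := t)))) has_real_derivative
      (\<Sum>r = 1..N+1. partial r f (\<phi> s) * partial k (\<lambda>s. \<phi> s r) s)) (at (s k))"
  using chain_rule[OF assms(1), of "\<lambda>t. \<phi> (s(k := t))" "\<lambda>r. partial k (\<lambda>s. \<phi> s r) s" "s k"]
    phi_has_partial[OF assms(2), of _ k] by simp

lemma dot_eq_sum:
  assumes "differentiable_along_curves N f" "s \<in> V"
  shows "dot k f s = (\<Sum>r = 1..N+1. partial r f (\<phi> s) * partial k (\<lambda>s. \<phi> s r) s)"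
  unfolding dot_def partial_def[of k "\<lambda>s. f (\<phi> s)"] by (rule DERIV_imp_deriv[OF has_dot_sum[OF assms]])

lemma has_dot:
  assumes "differentiable_along_curves N f" "s \<in> V"
  shows "((\<lambda>t. f (\<phi> (s(k := t)))) has_real_derivative dot k f s) (at (s k))"
  using has_dot_sum[OF assms] dot_eq_sum[OF assms] by simp

lemma dot_unique:
  assumes "((\<lambda>t. f (\<phi> (s(k := t)))) has_real_derivative D) (at (s k))"
  shows "dot k f s = D"
  using DERIV_imp_deriv[OF assms] by (simp add: dot_def partial_def)

lemma dot_const: "dot k (\<lambda>_. a) s = 0"
  by (rule dot_unique) simp

lemma dot_diff:
  assumes "differentiable_along_curves N f" "differentiable_along_curves N g" "s \<in> V"
  shows "dot k (\<lambda>u. f u - g u) s = dot k f s - dot k g s"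
  by (intro dot_unique DERIV_diff has_dot assms)

lemma dot_mult:
  assumes "differentiable_along_curves N f" "differentiable_along_curves N g" "s \<in> V"
  shows "dot k (\<lambda>u. f u * g u) s = dot k f s * g (\<phi> s) + f (\<phi> s) * dot k g s"
proof -
  have "dot k (\<lambda>u. f u * g u) s = dot k f s * g (\<phi> (s(k := s k))) + dot k g s * f (\<phi> (s(k := s k)))"
    by (intro dot_unique DERIV_mult has_dot assms)
  then show ?thesis by simp
qed

lemma dot_sum:
  assumes "\<And>a. a \<in> A \<Longrightarrow> differentiable_along_curves N (f a)" "s \<in> V"
  shows "dot k (\<lambda>u. \<Sum>a\<in>A. f a u) s = (\<Sum>a\<in>A. dot k (f a) s)"
  by (intro dot_unique DERIV_sum has_dot assms)

lemma dot_lcoef: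
  assumes "s \<in> V"
  shows "dot k (\<lambda>u. lcoef N u r) s = dser N k s r"
proof (rule dot_unique)
  show "((\<lambda>t. lcoef N (\<phi> (s(k := t))) r) has_real_derivative dser N k s r) (at (s k))"
    by (rule has_derivative_line_cong[OF sser_has_derivative assms lcoef_phi])
qed

lemma dot_last:
  assumes "s \<in> V"
  shows "dot k (\<lambda>u. u (N + 1)) s = (if N + 1 = k then 1 else 0)"
  by (rule dot_unique) (rule has_derivative_line_cong[OF coord_has_derivative assms phi_last])

end

section \<open>The transformed pair as sums over the coordinates u\<close>

text \<open>\<open>mm\<close> is the all-ones matrix plus a diagonal one. The former yields a
  product of two sums, the latter a single sum weighted by \<open>eta\<close>.\<close>

lemma sum_mm:
  "(\<Sum>p = 1..N+1. \<Sum>q = 1..N+1. mm N p q * a p * b q)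
    = (\<Sum>p = 1..N+1. a p) * (\<Sum>q = 1..N+1. b q) + (1 - real N) * (\<Sum>p = 1..N+1. eta N p * a p * b p)"
proof -
  have mm: "mm N p q = 1 + (if q = p then (1 - real N) * eta N p else 0)" for p q
    by (auto simp: mm_def eta_def)
  have "(\<Sum>q = 1..N+1. mm N p q * a p * b q)
      = a p * (\<Sum>q = 1..N+1. b q) + (1 - real N) * (eta N p * a p * b p)" if "p \<in> {1..N+1}" for p
  proof -
    have "(\<Sum>q = 1..N+1. mm N p q * a p * b q)
        = (\<Sum>q = 1..N+1. a p * b q) + (\<Sum>q = 1..N+1. if q = p then (1 - real N) * (eta N p * a p * b q) else 0)"
      unfolding sum.distrib[symmetric] by (rule sum.cong) (auto simp: mm algebra_simps)
    then show ?thesis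
      using that by (simp only: sum.delta finite_atLeastAtMost sum_distrib_left if_True)
  qed
  then have "(\<Sum>p = 1..N+1. \<Sum>q = 1..N+1. mm N p q * a p * b q)
      = (\<Sum>p = 1..N+1. a p * (\<Sum>q = 1..N+1. b q) + (1 - real N) * (eta N p * a p * b p))"
    by (rule sum.cong[OF refl])
  then show ?thesis
    by (simp only: sum.distrib sum_distrib_left[symmetric] sum_distrib_right[symmetric])
qed

text \<open>Absorbs the factors \<open>u p\<close> and \<open>u q\<close> of \<open>gU\<close> into
  the Jacobian, so that only the constant matrix \<open>mm\<close> remains in the
  contractions.\<close>

definition xcoef :: "nat \<Rightarrow> (nat \<Rightarrow> real) \<Rightarrow> nat \<Rightarrow> nat \<Rightarrow> real" where
  "xcoef N u i p = u p * ds N u i p"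

lemma xcoef_le:
  assumes "i \<in> {1..N}" "p \<in> {1..N+1}"
  shows "xcoef N u i p = eta N p * ycoef N u p i"
proof -
  obtain r where r: "i = Suc r" using assms(1) by (cases i) auto
  then show ?thesis
    using ds_eq[OF assms, of u] by (simp add: xcoef_def)
qed

lemma xcoef_last: "xcoef N u (N + 1) p = (if p = N + 1 then u (N + 1) else 0)"
  using ds_last[of N u p] by (simp add: xcoef_def)

lemma differentiable_along_curves_xcoef:
  assumes "i \<in> {1..N+1}" "p \<in> {1..N+1}"
  shows "differentiable_along_curves N (\<lambda>u. xcoef N u i p)"
  unfolding xcoef_def
  by (intro differentiable_along_curves_mult differentiable_along_curves_coord differentiable_along_curves_ds assms)

context local_inverse
begin

lemma gS_eq:
  "gS N \<phi> i j s = (\<Sum>p = 1..N+1. xcoef N (\<phi> s) i p) * (\<Sum>q = 1..N+1. xcoef N (\<phi> s) j q)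
     + (1 - real N) * (\<Sum>p = 1..N+1. eta N p * xcoef N (\<phi> s) i p * xcoef N (\<phi> s) j p)"
  unfolding sum_mm[symmetric] gS_def
  by (intro sum.cong refl) (simp add: gU_def xcoef_def)

text \<open>The two terms of the transformation rule combine by the product rule: as
  \<open>GamU\<close> is supported on q = r, the first differentiates the factor \<open>u q\<close>
  of \<open>xcoef N u j q\<close> and the second the factor \<open>ds N u j q\<close>.\<close>

lemma GamS_eq:
  assumes "s \<in> V" "j \<in> {1..N+1}"
  shows "GamS N \<phi> i j k s = (\<Sum>p = 1..N+1. xcoef N (\<phi> s) i p) * (\<Sum>q = 1..N+1. dot k (\<lambda>u. xcoef N u j q) s)
     + (1 - real N) * (\<Sum>p = 1..N+1. eta N p * xcoef N (\<phi> s) i p * dot k (\<lambda>u. xcoef N u j p) s)"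
  unfolding sum_mm[symmetric] GamS_def
proof (intro sum.cong refl)
  fix p q assume q: "q \<in> {1..N+1}"
  have dx: "dot k (\<lambda>u. xcoef N u j q) s = partial k (\<lambda>s. \<phi> s q) s * ds N (\<phi> s) j q
      + \<phi> s q * (\<Sum>r = 1..N+1. dds N (\<phi> s) j q r * partial k (\<lambda>s. \<phi> s r) s)"
    using dot_mult[OF differentiable_along_curves_coord[OF q] differentiable_along_curves_ds[OF assms(2) q] assms(1), of k]
      dot_eq_sum[OF differentiable_along_curves_ds[OF assms(2) q] assms(1), of k]
    unfolding xcoef_def dds_def ds_def[symmetric] by (simp add: dot_def)
  have "(\<Sum>r = 1..N+1. ds N (\<phi> s) i p * ds N (\<phi> s) j q * partial k (\<lambda>t. \<phi> t r) s * GamU N (\<phi> s) p q r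
      + ds N (\<phi> s) i p * dds N (\<phi> s) j q r * partial k (\<lambda>t. \<phi> t r) s * gU N (\<phi> s) p q)
    = (\<Sum>r = 1..N+1. if q = r then ds N (\<phi> s) i p * ds N (\<phi> s) j q * partial k (\<lambda>t. \<phi> t r) s * (mm N p q * \<phi> s p) else 0)
      + ds N (\<phi> s) i p * gU N (\<phi> s) p q * (\<Sum>r = 1..N+1. dds N (\<phi> s) j q r * partial k (\<lambda>s. \<phi> s r) s)"
    unfolding sum_distrib_left sum.distrib[symmetric]
    by (rule sum.cong) (auto simp: GamU_def algebra_simps)
  also have "\<dots> = mm N p q * xcoef N (\<phi> s) i p * dot k (\<lambda>u. xcoef N u j q) s"
    using q unfolding dx by (simp only: sum.delta' finite_atLeastAtMost if_True) (simp add: gU_def xcoef_def algebra_simps)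
  finally show "(\<Sum>r = 1..N+1. ds N (\<phi> s) i p * ds N (\<phi> s) j q * partial k (\<lambda>t. \<phi> t r) s * GamU N (\<phi> s) p q r
      + ds N (\<phi> s) i p * dds N (\<phi> s) j q r * partial k (\<lambda>t. \<phi> t r) s * gU N (\<phi> s) p q)
    = mm N p q * xcoef N (\<phi> s) i p * dot k (\<lambda>u. xcoef N u j q) s" .
qed

text \<open>Euler's identity: \<open>s i\<close> is homogeneous in u, of degree i for i at most N
  and of degree 1 for i = N + 1.\<close>

lemma sum_xcoef:
  assumes "s \<in> V" "i \<in> {1..N+1}"
  shows "(\<Sum>p = 1..N+1. xcoef N (\<phi> s) i p) = (if i = N + 1 then 1 else real i) * s i"
proof (cases "i = N + 1")
  case True
  then have "(\<Sum>p = 1..N+1. xcoef N (\<phi> s) i p) = (\<Sum>p = 1..N+1. if p = N + 1 then \<phi> s (N + 1) else 0)"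
    by (simp only: xcoef_last)
  then show ?thesis
    using phi_last[OF assms(1)] True by simp
next
  case False
  then have i: "i \<in> {1..N}" using assms(2) by auto
  then have "(\<Sum>p = 1..N+1. xcoef N (\<phi> s) i p) = real i * lcoef N (\<phi> s) i"
    unfolding euler_lcoef[symmetric] by (intro sum.cong refl xcoef_le)
  then show ?thesis
    using i lcoef_phi[OF assms(1), of i] by (simp add: sser_def)
qed

text \<open>Summing before differentiating leaves the derivative of a multiple of
  \<open>s j\<close>.\<close>

lemma sum_dot_xcoef:
  assumes "s \<in> V" "j \<in> {1..N+1}"
  shows "(\<Sum>p = 1..N+1. dot k (\<lambda>u. xcoef N u j p) s) = (if j = k then if j = N + 1 then 1 else real j else 0)"
proof -
  let ?d = "if j = N + 1 then 1 else real j"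
  have "(\<Sum>p = 1..N+1. dot k (\<lambda>u. xcoef N u j p) s) = dot k (\<lambda>u. \<Sum>p = 1..N+1. xcoef N u j p) s"
    by (rule dot_sum[symmetric]) (use assms differentiable_along_curves_xcoef in auto)
  also have "\<dots> = ?d * (if j = k then 1 else 0)"
  proof (rule dot_unique)
    show "((\<lambda>t. \<Sum>p = 1..N+1. xcoef N (\<phi> (s(k := t))) j p) has_real_derivative ?d * (if j = k then 1 else 0)) (at (s k))"
      by (rule has_derivative_line_cong[OF DERIV_cmult[OF coord_has_derivative] assms(1) sum_xcoef[OF _ assms(2)]])
  qed
  finally show ?thesis by simp
qed

section \<open>Affine and constant dependence on the coordinate N - 1\<close>

text \<open>One pair of coefficients serves the whole part of the line inside \<open>V\<close>, even
  if that part is disconnected.\<close>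

definition affine_line :: "(nat \<Rightarrow> real) \<Rightarrow> ((nat \<Rightarrow> real) \<Rightarrow> real) \<Rightarrow> bool" where
  "affine_line s f \<longleftrightarrow> (\<exists>a b. \<forall>t. s(N - 1 := t) \<in> V \<longrightarrow> f (s(N - 1 := t)) = a + b * t)"

definition constant_line :: "(nat \<Rightarrow> real) \<Rightarrow> ((nat \<Rightarrow> real) \<Rightarrow> real) \<Rightarrow> bool" where
  "constant_line s f \<longleftrightarrow> (\<exists>a. \<forall>t. s(N - 1 := t) \<in> V \<longrightarrow> f (s(N - 1 := t)) = a)"

lemma affine_line_cong:
  assumes "affine_line s g" "\<And>s'. s' \<in> V \<Longrightarrow> f s' = g s'"
  shows "affine_line s f"
  using assms unfolding affine_line_def by metis

lemma constant_imp_affine: "constant_line s f \<Longrightarrow> affine_line s f"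
  unfolding constant_line_def affine_line_def by (metis add.right_neutral mult_zero_left)

lemma constant_lineI: "(\<And>t. f (s(N - 1 := t)) = f s) \<Longrightarrow> constant_line s f"
  unfolding constant_line_def by blast

lemma constant_line_const: "constant_line s (\<lambda>_. a)"
  unfolding constant_line_def by auto

lemma constant_line_mult:
  assumes "constant_line s f" "constant_line s g"
  shows "constant_line s (\<lambda>s. f s * g s)"
  using assms unfolding constant_line_def by (metis (full_types))

lemma constant_line_coord: "i \<noteq> N - 1 \<Longrightarrow> constant_line s (\<lambda>s. s i)"
  unfolding constant_line_def by auto

lemma affine_line_const: "affine_line s (\<lambda>_. a)"
  by (intro constant_imp_affine constant_line_const)

lemma affine_line_coord: "affine_line s (\<lambda>s. s i)"
proof (cases "i = N - 1")
  case True
  then show ?thesis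
    unfolding affine_line_def by (intro exI[of _ 0] exI[of _ 1]) simp
qed (intro constant_imp_affine constant_line_coord)

lemma affine_line_add:
  assumes "affine_line s f" "affine_line s g"
  shows "affine_line s (\<lambda>s. f s + g s)"
proof -
  obtain a b c d where "\<forall>t. s(N - 1 := t) \<in> V \<longrightarrow> f (s(N - 1 := t)) = a + b * t"
    "\<forall>t. s(N - 1 := t) \<in> V \<longrightarrow> g (s(N - 1 := t)) = c + d * t"
    using assms unfolding affine_line_def by blast
  then show ?thesis
    unfolding affine_line_def by (intro exI[of _ "a + c"] exI[of _ "b + d"]) (auto simp: algebra_simps)
qed

lemma affine_line_constant_mult:
  assumes "constant_line s f" "affine_line s g"
  shows "affine_line s (\<lambda>s. f s * g s)"
proof -
  obtain a c d where "\<forall>t. s(N - 1 := t) \<in> V \<longrightarrow> f (s(N - 1 := t)) = a"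
    "\<forall>t. s(N - 1 := t) \<in> V \<longrightarrow> g (s(N - 1 := t)) = c + d * t"
    using assms unfolding affine_line_def constant_line_def by blast
  then show ?thesis
    unfolding affine_line_def by (intro exI[of _ "a * c"] exI[of _ "a * d"]) (auto simp: algebra_simps)
qed

lemma affine_line_mult_constant:
  assumes "affine_line s f" "constant_line s g"
  shows "affine_line s (\<lambda>s. f s * g s)"
  using affine_line_constant_mult[OF assms(2,1)] by (simp add: mult.commute)

lemma affine_line_cmult: "affine_line s f \<Longrightarrow> affine_line s (\<lambda>s. a * f s)"
  by (intro affine_line_constant_mult constant_line_const)

lemma affine_line_diff:
  assumes "affine_line s f" "affine_line s g"
  shows "affine_line s (\<lambda>s. f s - g s)"
  using affine_line_add[OF assms(1) affine_line_cmult[OF assms(2), of "-1"]] by simp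

text \<open>The line meets \<open>V\<close> in an open set, so the first derivative is the constant
  \<open>b\<close> near the point and can be differentiated again.\<close>

lemma second_partial_affine:
  assumes "affine_line s f" "s \<in> V"
  shows "partial (N - 1) (partial (N - 1) f) s = 0"
proof -
  let ?K = "N - 1"
  obtain a b where ab: "\<And>t. s(?K := t) \<in> V \<Longrightarrow> f (s(?K := t)) = a + b * t"
    using assms(1) unfolding affine_line_def by blast
  have "partial ?K f (s(?K := t)) = b" if t: "s(?K := t) \<in> V" for t
  proof -
    have "((\<lambda>t'. a + b * t') has_real_derivative b) (at t)"
      by (auto intro!: derivative_eq_intros)
    then have "((\<lambda>t'. f (s(?K := t'))) has_real_derivative b) (at t)"
      by (rule has_field_derivative_transform_within_open[OF _ open_line[of s ?K]]) (use t ab in auto)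
    then show ?thesis by (simp add: partial_def DERIV_imp_deriv)
  qed
  then have "((\<lambda>t. partial ?K f (s(?K := t))) has_real_derivative 0) (at (s ?K))"
    by (intro has_field_derivative_transform_within_open[OF DERIV_const[of b] open_line[of s ?K]]) (use assms(2) in auto)
  then show ?thesis
    unfolding partial_def[of ?K "partial ?K f"] by (rule DERIV_imp_deriv)
qed

text \<open>\<open>s (N - 1)\<close> is a single coefficient of the series; the geometric tail is
  built from \<open>s N\<close> and \<open>s (N + 1)\<close>.\<close>

lemma constant_line_sser: "r \<noteq> N - 1 \<Longrightarrow> constant_line s (\<lambda>s. sser N s r)"
  using N_ge_2 by (intro constant_lineI) (auto simp: sser_def)

lemma affine_line_sser: "affine_line s (\<lambda>s. sser N s r)"
proof (cases "r = N - 1")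
  case True
  then show ?thesis
    using N_ge_2 affine_line_coord[of s r] by (simp add: sser_def)
qed (intro constant_imp_affine constant_line_sser)

lemma constant_line_dser: "constant_line s (\<lambda>s. dser N k s r)"
  using N_ge_2 by (intro constant_lineI) (auto simp: dser_def)

text \<open>The only product quadratic in \<open>s (N - 1)\<close> is its square, which is split off
  here and cancelled in the metric.\<close>

lemma affine_line_sser_mult:
  "affine_line s (\<lambda>s. sser N s i * sser N s j - (if i = N - 1 \<and> j = N - 1 then (s (N - 1))\<^sup>2 else 0))"
proof -
  consider "i = N - 1" "j = N - 1" | "i \<noteq> N - 1" | "j \<noteq> N - 1" by blast
  then show ?thesis
  proof cases
    case 1
    then show ?thesis
      using N_ge_2 affine_line_const[of s 0] by (simp add: sser_def power2_eq_square)
  next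
    case 2
    then show ?thesis
      using affine_line_constant_mult[OF constant_line_sser affine_line_sser] by simp
  next
    case 3
    then show ?thesis
      using affine_line_mult_constant[OF affine_line_sser constant_line_sser] by simp
  qed
qed

section \<open>Recursions and sums that stay affine\<close>

text \<open>The pole coordinate is \<open>s (N + 1)\<close> itself, so this recursion closes over s:
  its multiplier is constant along the line and its inhomogeneity affine.\<close>

lemma affine_line_tcoef_last: "affine_line s (\<lambda>s. tcoef N (\<phi> s) (N + 1) r)"
proof (induction r)
  case (Suc r)
  have "affine_line s (\<lambda>s. sser N s (Suc r) - s (N + 1) * tcoef N (\<phi> s) (N + 1) r)"
    by (intro affine_line_diff affine_line_sser affine_line_constant_mult constant_line_coord Suc) auto
  then show ?case
    by (rule affine_line_cong) (simp add: lcoef_phi phi_last[simplified] del: lcoef.simps)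
qed (simp add: affine_line_const)

lemma affine_line_dot_tcoef_last: "affine_line s (\<lambda>s. dot k (\<lambda>u. tcoef N u (N + 1) r) s)"
proof (induction r)
  case (Suc r)
  have N1: "N + 1 \<in> {1..N+1}" by simp
  have "affine_line s (\<lambda>s. dser N k s (Suc r) - ((if N + 1 = k then 1 else 0) * tcoef N (\<phi> s) (N + 1) r
      + s (N + 1) * dot k (\<lambda>u. tcoef N u (N + 1) r) s))"
    by (intro affine_line_diff affine_line_add affine_line_cmult affine_line_tcoef_last constant_imp_affine[OF constant_line_dser]
        affine_line_constant_mult constant_line_coord Suc) auto
  then show ?case
  proof (rule affine_line_cong)
    fix s assume s: "s \<in> V"
    show "dot k (\<lambda>u. tcoef N u (N + 1) (Suc r)) s = dser N k s (Suc r) - ((if N + 1 = k then 1 else 0) * tcoef N (\<phi> s) (N + 1) r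
      + s (N + 1) * dot k (\<lambda>u. tcoef N u (N + 1) r) s)"
      unfolding tcoef.simps
      by (subst dot_diff dot_mult, (intro differentiable_along_curves_intros differentiable_along_curves_lcoef
            differentiable_along_curves_tcoef s N1)+)+
         (simp only: dot_lcoef[OF s] dot_last[OF s] phi_last[OF s])
  qed
qed (simp add: dot_const affine_line_const)

lemma sum_dot_lcoef:
  assumes "s \<in> V"
  shows "(\<Sum>p = 1..N+1. eta N p * dot k (\<lambda>u. u p) s * tcoef N (\<phi> s) p r) = dser N k s (Suc r)"
proof -
  have "dser N k s (Suc r) = (\<Sum>p = 1..N+1. partial p (\<lambda>u. lcoef N u (Suc r)) (\<phi> s) * partial k (\<lambda>s. \<phi> s p) s)"
    unfolding dot_lcoef[OF assms, symmetric] by (rule dot_eq_sum[OF differentiable_along_curves_lcoef assms])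
  also have "\<dots> = (\<Sum>p = 1..N+1. eta N p * dot k (\<lambda>u. u p) s * tcoef N (\<phi> s) p r)"
    by (rule sum.cong[OF refl]) (simp add: partial_lcoef dot_def del: lcoef.simps)
  finally show ?thesis ..
qed

text \<open>The derivative of Euler's identity \<open>euler_lcoef\<close>.\<close>

lemma sum_dot_ycoef:
  assumes "s \<in> V"
  shows "(\<Sum>p = 1..N+1. eta N p * dot k (\<lambda>u. ycoef N u p r) s) = real r * dser N k s r"
proof -
  have "(\<Sum>p = 1..N+1. eta N p * dot k (\<lambda>u. ycoef N u p r) s)
      = (\<Sum>p = 1..N+1. dot k (\<lambda>u. eta N p * ycoef N u p r) s)"
    by (intro sum.cong refl)
       (simp add: dot_mult[OF differentiable_along_curves_const differentiable_along_curves_ycoef assms] dot_const)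
  also have "\<dots> = dot k (\<lambda>u. \<Sum>p = 1..N+1. eta N p * ycoef N u p r) s"
    by (rule dot_sum[symmetric, OF differentiable_along_curves_mult[OF differentiable_along_curves_const
          differentiable_along_curves_ycoef] assms])
  also have "\<dots> = real r * dser N k s r"
    unfolding euler_lcoef dot_mult[OF differentiable_along_curves_const differentiable_along_curves_lcoef assms]
    by (simp add: dot_const dot_lcoef[OF assms])
  finally show ?thesis .
qed

lemma dot_tcoef:
  assumes "s \<in> V" "p \<in> {1..N+1}"
  shows "dot k (\<lambda>u. tcoef N u p r) s = dser N k s r - dot k (\<lambda>u. ycoef N u p r) s"
  unfolding tcoef_eq dot_diff[OF differentiable_along_curves_lcoef differentiable_along_curves_ycoef[OF assms(2)] assms(1)]
    dot_lcoef[OF assms(1)] ..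

lemma dot_ycoef_Suc:
  assumes "s \<in> V" "p \<in> {1..N+1}"
  shows "dot k (\<lambda>u. ycoef N u p (Suc r)) s = dot k (\<lambda>u. u p) s * tcoef N (\<phi> s) p r
      + \<phi> s p * (dser N k s r - dot k (\<lambda>u. ycoef N u p r) s)"
  unfolding ycoef_Suc dot_tcoef[OF assms, symmetric]
  by (rule dot_mult[OF differentiable_along_curves_coord differentiable_along_curves_tcoef]) (use assms in auto)

text \<open>The next three inductions read off coefficients of generating functions in z and w after
  multiplication by \<open>z - w\<close>; each step trades i for j along a line of constant i + j.\<close>

lemma affine_line_tcoef_tcoef:
  "affine_line s (\<lambda>s. \<Sum>p = 1..N+1. eta N p * dot k (\<lambda>u. u p) s * tcoef N (\<phi> s) p i * tcoef N (\<phi> s) p j)"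
proof (induction i arbitrary: j)
  case 0
  have "affine_line s (\<lambda>s. dser N k s (Suc j))"
    by (rule constant_imp_affine[OF constant_line_dser])
  then show ?case
    by (rule affine_line_cong) (simp only: tcoef.simps mult_1_right sum_dot_lcoef)
next
  case (Suc i)
  \<comment> \<open>Write S, T, Y for \<open>lcoef\<close>, \<open>tcoef\<close>,
    \<open>ycoef\<close>. Then T(i+1) T(j) - T(i) T(j+1) = S(i+1) T(j) - S(j+1) T(i), as the terms
    \<open>u p\<close> T(i) T(j) cancel; \<open>sum_dot_lcoef\<close> sums the right-hand
    side.\<close>
  have "affine_line s (\<lambda>s. (\<Sum>p = 1..N+1. eta N p * dot k (\<lambda>u. u p) s * tcoef N (\<phi> s) p i * tcoef N (\<phi> s) p (Suc j))
      + (sser N s (Suc i) * dser N k s (Suc j) - sser N s (Suc j) * dser N k s (Suc i)))"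
    by (intro affine_line_add affine_line_diff affine_line_mult_constant affine_line_sser constant_line_dser Suc)
  then show ?case
  proof (rule affine_line_cong)
    fix s assume s: "s \<in> V"
    have "eta N p * dot k (\<lambda>u. u p) s * tcoef N (\<phi> s) p (Suc i) * tcoef N (\<phi> s) p j
      = eta N p * dot k (\<lambda>u. u p) s * tcoef N (\<phi> s) p i * tcoef N (\<phi> s) p (Suc j)
       + (sser N s (Suc i) * (eta N p * dot k (\<lambda>u. u p) s * tcoef N (\<phi> s) p j)
         - sser N s (Suc j) * (eta N p * dot k (\<lambda>u. u p) s * tcoef N (\<phi> s) p i))" for p
      by (simp only: tcoef.simps lcoef_phi[OF s]) algebra
    then show "(\<Sum>p = 1..N+1. eta N p * dot k (\<lambda>u. u p) s * tcoef N (\<phi> s) p (Suc i) * tcoef N (\<phi> s) p j)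
      = (\<Sum>p = 1..N+1. eta N p * dot k (\<lambda>u. u p) s * tcoef N (\<phi> s) p i * tcoef N (\<phi> s) p (Suc j))
      + (sser N s (Suc i) * dser N k s (Suc j) - sser N s (Suc j) * dser N k s (Suc i))"
      by (simp only: sum.distrib sum_subtractf sum_distrib_left[symmetric] sum_dot_lcoef[OF s])
  qed
qed

lemma affine_line_ycoef_dot:
  "affine_line s (\<lambda>s. \<Sum>p = 1..N+1. eta N p * ycoef N (\<phi> s) p i * dot k (\<lambda>u. ycoef N u p j) s)"
proof (induction i arbitrary: j)
  case 0
  then show ?case by (simp add: affine_line_const)
next
  case (Suc i)
  \<comment> \<open>The exchange rule is \<open>dot_ycoef_Suc\<close> multiplied by T(i) = S(i) -
    Y(i). Euler's identity and its derivative sum two of the terms; the product T(i) T(j) left over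
    accounts for the squared denominator of the overview.\<close>
  have "affine_line s (\<lambda>s. (\<Sum>p = 1..N+1. eta N p * ycoef N (\<phi> s) p i * dot k (\<lambda>u. ycoef N u p (Suc j)) s)
      - (sser N s i * (real (Suc j) * dser N k s (Suc j)) - (real (Suc i) * sser N s (Suc i)) * dser N k s j
        - (\<Sum>p = 1..N+1. eta N p * dot k (\<lambda>u. u p) s * tcoef N (\<phi> s) p i * tcoef N (\<phi> s) p j)))"
    by (intro affine_line_diff affine_line_mult_constant affine_line_cmult affine_line_sser constant_line_mult
        constant_line_const constant_line_dser affine_line_tcoef_tcoef Suc)
  then show ?case
  proof (rule affine_line_cong)
    fix s assume s: "s \<in> V"
    have "eta N p * ycoef N (\<phi> s) p (Suc i) * dot k (\<lambda>u. ycoef N u p j) s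
      = eta N p * ycoef N (\<phi> s) p i * dot k (\<lambda>u. ycoef N u p (Suc j)) s
       - (sser N s i * (eta N p * dot k (\<lambda>u. ycoef N u p (Suc j)) s) - (eta N p * ycoef N (\<phi> s) p (Suc i)) * dser N k s j
         - eta N p * dot k (\<lambda>u. u p) s * tcoef N (\<phi> s) p i * tcoef N (\<phi> s) p j)" if "p \<in> {1..N+1}" for p
      unfolding dot_ycoef_Suc[OF s that] unfolding ycoef_Suc tcoef_eq lcoef_phi[OF s] by algebra
    then have "(\<Sum>p = 1..N+1. eta N p * ycoef N (\<phi> s) p (Suc i) * dot k (\<lambda>u. ycoef N u p j) s)
      = (\<Sum>p = 1..N+1. eta N p * ycoef N (\<phi> s) p i * dot k (\<lambda>u. ycoef N u p (Suc j)) s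
       - (sser N s i * (eta N p * dot k (\<lambda>u. ycoef N u p (Suc j)) s) - (eta N p * ycoef N (\<phi> s) p (Suc i)) * dser N k s j
         - eta N p * dot k (\<lambda>u. u p) s * tcoef N (\<phi> s) p i * tcoef N (\<phi> s) p j))"
      by (rule sum.cong[OF refl])
    then show "(\<Sum>p = 1..N+1. eta N p * ycoef N (\<phi> s) p (Suc i) * dot k (\<lambda>u. ycoef N u p j) s)
      = (\<Sum>p = 1..N+1. eta N p * ycoef N (\<phi> s) p i * dot k (\<lambda>u. ycoef N u p (Suc j)) s)
      - (sser N s i * (real (Suc j) * dser N k s (Suc j)) - (real (Suc i) * sser N s (Suc i)) * dser N k s j
        - (\<Sum>p = 1..N+1. eta N p * dot k (\<lambda>u. u p) s * tcoef N (\<phi> s) p i * tcoef N (\<phi> s) p j))"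
      by (simp only: sum_subtractf sum_distrib_left[symmetric] sum_distrib_right[symmetric]
          sum_dot_ycoef[OF s] euler_lcoef lcoef_phi[OF s])
  qed
qed

text \<open>The subtracted square is cancelled in the metric by the product of the two Euler terms.\<close>

lemma affine_line_ycoef_ycoef:
  "affine_line s (\<lambda>s. (\<Sum>p = 1..N+1. eta N p * ycoef N (\<phi> s) p i * ycoef N (\<phi> s) p j)
      - real (N - 1) * (if i = N - 1 \<and> j = N - 1 then (s (N - 1))\<^sup>2 else 0))"
proof (induction i arbitrary: j)
  case 0
  then show ?case using N_ge_2 by (simp add: affine_line_const)
next
  case (Suc i)
  let ?I = "\<lambda>i j s. if i = N - 1 \<and> j = N - 1 then (s (N - 1))\<^sup>2 else (0::real)"
  \<comment> \<open>The exchange rule is Y(i+1) Y(j) = Y(i) Y(j+1) - S(i) Y(j+1) + Y(i+1) S(j), and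
    Euler's identity sums the last two terms. Each product carries its own subtracted square, which
    makes each bracket affine.\<close>
  have "affine_line s (\<lambda>s. ((\<Sum>p = 1..N+1. eta N p * ycoef N (\<phi> s) p i * ycoef N (\<phi> s) p (Suc j)) - real (N - 1) * ?I i (Suc j) s)
      - real (Suc j) * (sser N s i * sser N s (Suc j) - ?I i (Suc j) s)
      + real (Suc i) * (sser N s (Suc i) * sser N s j - ?I (Suc i) j s))"
    by (intro affine_line_add affine_line_diff affine_line_cmult affine_line_sser_mult Suc)
  then show ?case
  proof (rule affine_line_cong)
    fix s assume s: "s \<in> V"
    have "eta N p * ycoef N (\<phi> s) p (Suc i) * ycoef N (\<phi> s) p j
      = eta N p * ycoef N (\<phi> s) p i * ycoef N (\<phi> s) p (Suc j)
       - (sser N s i * (eta N p * ycoef N (\<phi> s) p (Suc j)) - (eta N p * ycoef N (\<phi> s) p (Suc i)) * sser N s j)" for p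
      unfolding ycoef_Suc tcoef_eq lcoef_phi[OF s] by algebra
    then have "(\<Sum>p = 1..N+1. eta N p * ycoef N (\<phi> s) p (Suc i) * ycoef N (\<phi> s) p j)
      = (\<Sum>p = 1..N+1. eta N p * ycoef N (\<phi> s) p i * ycoef N (\<phi> s) p (Suc j))
      - (sser N s i * (real (Suc j) * sser N s (Suc j)) - (real (Suc i) * sser N s (Suc i)) * sser N s j)"
      by (simp only: sum_subtractf sum_distrib_left[symmetric] sum_distrib_right[symmetric]
          euler_lcoef lcoef_phi[OF s])
    \<comment> \<open>Where the indicator can be nonzero its indices equal N - 1, so the Euler
      factors agree with \<open>real (N - 1)\<close>.\<close>
    moreover have "real (N - 1) * ?I i (Suc j) s = real (Suc j) * ?I i (Suc j) s"
      "real (N - 1) * ?I (Suc i) j s = real (Suc i) * ?I (Suc i) j s" by auto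
    ultimately show "(\<Sum>p = 1..N+1. eta N p * ycoef N (\<phi> s) p (Suc i) * ycoef N (\<phi> s) p j) - real (N - 1) * ?I (Suc i) j s
      = ((\<Sum>p = 1..N+1. eta N p * ycoef N (\<phi> s) p i * ycoef N (\<phi> s) p (Suc j)) - real (N - 1) * ?I i (Suc j) s)
      - real (Suc j) * (sser N s i * sser N s (Suc j) - ?I i (Suc j) s)
      + real (Suc i) * (sser N s (Suc i) * sser N s j - ?I (Suc i) j s)"
      by (simp only: algebra_simps)
  qed
qed

end

section \<open>Assembling the components of the transformed pair\<close>

lemma sum_eta_last: "(\<Sum>p = 1..N+1. eta N p * (if p = N + 1 then a else 0) * b p) = - a * b (N + 1)"
proof -
  have "(\<Sum>p = 1..N+1. eta N p * (if p = N + 1 then a else 0) * b p) = (\<Sum>p = 1..N+1. if p = N + 1 then - a * b p else 0)"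
    by (rule sum.cong) (auto simp: eta_def)
  then show ?thesis by simp
qed

lemma eta_mult_eta: "eta N p * eta N p = 1"
  by (simp add: eta_def)

context local_inverse
begin

text \<open>In the metric, an index N + 1 reduces the weighted sum to this entry, where
  \<open>u (N + 1)\<close> is \<open>s (N + 1)\<close>.\<close>

lemma affine_line_xcoef_pole:
  assumes "j \<in> {1..N+1}"
  shows "affine_line s (\<lambda>s. xcoef N (\<phi> s) j (N + 1))"
proof (cases "j = N + 1")
  case True
  show ?thesis
    by (rule affine_line_cong[OF affine_line_coord[of s "N + 1"]])
       (simp only: True xcoef_last phi_last simp_thms if_True)
next
  case False
  then obtain r where r: "j = Suc r" "j \<in> {1..N}" using assms by (cases j) auto
  have "affine_line s (\<lambda>s. -1 * (s (N + 1) * tcoef N (\<phi> s) (N + 1) r))"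
    by (intro affine_line_cmult affine_line_constant_mult constant_line_coord affine_line_tcoef_last) simp
  then show ?thesis
    by (rule affine_line_cong)
       (use r xcoef_le[of j N "N + 1"] phi_last in \<open>auto simp: eta_def\<close>)
qed

lemma affine_line_dot_xcoef_pole:
  assumes "j \<in> {1..N+1}"
  shows "affine_line s (\<lambda>s. dot k (\<lambda>u. xcoef N u j (N + 1)) s)"
proof (cases "j = N + 1")
  case True
  show ?thesis
    by (rule affine_line_cong[OF affine_line_const[of s "if N + 1 = k then 1 else 0"]])
       (simp only: True xcoef_last dot_last simp_thms if_True)
next
  case False
  then obtain r where r: "j = Suc r" "j \<in> {1..N}" using assms by (cases j) auto
  have N1: "N + 1 \<in> {1..N+1}" by simp
  have "affine_line s (\<lambda>s. -1 * ((if N + 1 = k then 1 else 0) * tcoef N (\<phi> s) (N + 1) r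
      + s (N + 1) * dot k (\<lambda>u. tcoef N u (N + 1) r) s))"
    by (intro affine_line_cmult affine_line_add affine_line_constant_mult[OF constant_line_coord]
        affine_line_tcoef_last affine_line_dot_tcoef_last) simp
  then show ?thesis
  proof (rule affine_line_cong)
    fix s assume s: "s \<in> V"
    have "(\<lambda>u. xcoef N u j (N + 1)) = (\<lambda>u. -1 * (u (N + 1) * tcoef N u (N + 1) r))"
      using r xcoef_le[of j N "N + 1"] by (auto simp: eta_def)
    then have "dot k (\<lambda>u. xcoef N u j (N + 1)) s = dot k (\<lambda>u. -1 * (u (N + 1) * tcoef N u (N + 1) r)) s"
      by simp
    also have "\<dots> = 0 * (\<phi> s (N + 1) * tcoef N (\<phi> s) (N + 1) r) + -1 * (dot k (\<lambda>u. u (N + 1)) s * tcoef N (\<phi> s) (N + 1) r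
        + \<phi> s (N + 1) * dot k (\<lambda>u. tcoef N u (N + 1) r) s)"
      by (subst dot_mult[OF _ _ s], (intro differentiable_along_curves_intros differentiable_along_curves_tcoef N1)+)+
         (simp only: dot_const)
    finally show "dot k (\<lambda>u. xcoef N u j (N + 1)) s = -1 * ((if N + 1 = k then 1 else 0) * tcoef N (\<phi> s) (N + 1) r
      + s (N + 1) * dot k (\<lambda>u. tcoef N u (N + 1) r) s)"
      by (simp only: dot_last[OF s] phi_last[OF s] mult_zero_left add_0_left)
  qed
qed

lemma affine_line_gS:
  assumes "i \<in> {1..N+1}" "j \<in> {1..N+1}"
  shows "affine_line s (gS N \<phi> i j)"
proof -
  have N1: "N + 1 \<in> {1..N+1}" by simp
  \<comment> \<open>For the index N + 1 all entries of \<open>xcoef\<close> off p = N + 1 vanish,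
    and the prefactor \<open>s (N + 1)\<close> is constant along the line.\<close>
  have last: "affine_line s (gS N \<phi> (N + 1) j)" if j: "j \<in> {1..N+1}" for j
  proof -
    have "affine_line s (\<lambda>s. s (N + 1) * ((if j = N + 1 then 1 else real j) * s j)
        + (1 - real N) * (-1 * (s (N + 1) * xcoef N (\<phi> s) j (N + 1))))"
      by (intro affine_line_add affine_line_cmult affine_line_constant_mult[OF constant_line_coord]
          affine_line_coord affine_line_xcoef_pole j) auto
    then show ?thesis
    proof (rule affine_line_cong)
      fix s assume s: "s \<in> V"
      show "gS N \<phi> (N + 1) j s = s (N + 1) * ((if j = N + 1 then 1 else real j) * s j)
        + (1 - real N) * (-1 * (s (N + 1) * xcoef N (\<phi> s) j (N + 1)))"
        unfolding gS_eq sum_xcoef[OF s j] sum_xcoef[OF s N1] xcoef_last sum_eta_last phi_last[OF s] by simp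
    qed
  qed
  have sym: "gS N \<phi> i j = gS N \<phi> j i"
    unfolding gS_eq by (intro ext) (simp only: mult.commute mult.left_commute)
  show ?thesis
  proof (cases "i = N + 1 \<or> j = N + 1")
    case True
    then show ?thesis
    proof
      assume "i = N + 1"
      then show ?thesis using last[OF assms(2)] by (simp only:)
    next
      assume "j = N + 1"
      then show ?thesis using last[OF assms(1)] sym by (simp only:)
    qed
  next
    case False
    then have ij: "i \<in> {1..N}" "j \<in> {1..N}" using assms by auto
    let ?I = "\<lambda>s. if i = N - 1 \<and> j = N - 1 then (s (N - 1))\<^sup>2 else (0::real)"
    have "affine_line s (\<lambda>s. real i * real j * (sser N s i * sser N s j - ?I s)
        + (1 - real N) * ((\<Sum>p = 1..N+1. eta N p * ycoef N (\<phi> s) p i * ycoef N (\<phi> s) p j) - real (N - 1) * ?I s))"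
      by (intro affine_line_add affine_line_cmult affine_line_sser_mult affine_line_ycoef_ycoef)
    then show ?thesis
    proof (rule affine_line_cong)
      fix s assume s: "s \<in> V"
      have "(\<Sum>p = 1..N+1. eta N p * xcoef N (\<phi> s) i p * xcoef N (\<phi> s) j p)
          = (\<Sum>p = 1..N+1. eta N p * ycoef N (\<phi> s) p i * ycoef N (\<phi> s) p j)"
        by (rule sum.cong[OF refl]) (use eta_mult_eta in \<open>simp add: xcoef_le[OF ij(1)] xcoef_le[OF ij(2)]\<close>)
      \<comment> \<open>The Euler product contributes the square (N - 1)^2 times, the weighted sum
        (1 - N)(N - 1) times.\<close>
      moreover have "real i * real j * ?I s + (1 - real N) * (real (N - 1) * ?I s) = 0"
        using N_ge_2 by (auto simp: of_nat_diff algebra_simps)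
      ultimately show "gS N \<phi> i j s = real i * real j * (sser N s i * sser N s j - ?I s)
        + (1 - real N) * ((\<Sum>p = 1..N+1. eta N p * ycoef N (\<phi> s) p i * ycoef N (\<phi> s) p j) - real (N - 1) * ?I s)"
        unfolding gS_eq sum_xcoef[OF s assms(1)] sum_xcoef[OF s assms(2)]
        using ij by (simp add: sser_def algebra_simps)
    qed
  qed
qed

lemma affine_line_GamS:
  assumes "i \<in> {1..N+1}" "j \<in> {1..N+1}"
  shows "affine_line s (GamS N \<phi> i j k)"
proof -
  \<comment> \<open>Only this sum needs work: the product of the two other sums is
    \<open>s i\<close> times a constant, by \<open>sum_xcoef\<close> and
    \<open>sum_dot_xcoef\<close>.\<close>
  have *: "affine_line s (\<lambda>s. \<Sum>p = 1..N+1. eta N p * xcoef N (\<phi> s) i p * dot k (\<lambda>u. xcoef N u j p) s)"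
  proof -
    consider (1) "i = N + 1" | (2) "j = N + 1" | (3) "i \<in> {1..N}" "j \<in> {1..N}"
      using assms by fastforce
    then show ?thesis
    proof cases
      case 1
      have "affine_line s (\<lambda>s. -1 * (s (N + 1) * dot k (\<lambda>u. xcoef N u j (N + 1)) s))"
        by (intro affine_line_cmult affine_line_constant_mult[OF constant_line_coord] affine_line_dot_xcoef_pole assms) simp
      then show ?thesis
        by (rule affine_line_cong) (simp only: 1 xcoef_last sum_eta_last phi_last mult_minus1 minus_mult_left)
    next
      \<comment> \<open>Now the differentiated factor is supported at p = N + 1, with a constant
        value.\<close>
      case 2
      have "affine_line s (\<lambda>s. -(if N + 1 = k then 1 else 0) * xcoef N (\<phi> s) i (N + 1))"
        by (intro affine_line_cmult affine_line_xcoef_pole assms)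
      then show ?thesis
      proof (rule affine_line_cong)
        fix s assume s: "s \<in> V"
        have "dot k (\<lambda>u. xcoef N u j p) s = (if p = N + 1 then if N + 1 = k then 1 else 0 else 0)" for p
          unfolding 2 xcoef_last by (cases "p = N + 1") (simp_all only: dot_last[OF s] dot_const simp_thms if_True if_False)
        then have "(\<Sum>p = 1..N+1. eta N p * xcoef N (\<phi> s) i p * dot k (\<lambda>u. xcoef N u j p) s)
          = (\<Sum>p = 1..N+1. eta N p * (if p = N + 1 then if N + 1 = k then 1 else 0 else 0) * xcoef N (\<phi> s) i p)"
          by (intro sum.cong refl) (simp only: mult.commute mult.left_commute)
        then show "(\<Sum>p = 1..N+1. eta N p * xcoef N (\<phi> s) i p * dot k (\<lambda>u. xcoef N u j p) s)
          = -(if N + 1 = k then 1 else 0) * xcoef N (\<phi> s) i (N + 1)"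
          unfolding sum_eta_last .
      qed
    next
      case 3
      show ?thesis
      proof (rule affine_line_cong[OF affine_line_ycoef_dot[of s i k j]], rule sum.cong[OF refl])
        fix s p assume s: "s \<in> V" and p: "p \<in> {1..N+1}"
        have "(\<lambda>u. xcoef N u j p) = (\<lambda>u. eta N p * ycoef N u p j)"
          using xcoef_le[OF 3(2) p] by blast
        then have "dot k (\<lambda>u. xcoef N u j p) s = eta N p * dot k (\<lambda>u. ycoef N u p j) s"
          by (simp add: dot_mult[OF differentiable_along_curves_const differentiable_along_curves_ycoef[OF p] s] dot_const)
        then show "eta N p * xcoef N (\<phi> s) i p * dot k (\<lambda>u. xcoef N u j p) s
          = eta N p * ycoef N (\<phi> s) p i * dot k (\<lambda>u. ycoef N u p j) s"
          using eta_mult_eta[of N p] by (simp add: xcoef_le[OF 3(1) p])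
      qed
    qed
  qed
  have "affine_line s (\<lambda>s. (if i = N + 1 then 1 else real i) * s i * (if j = k then if j = N + 1 then 1 else real j else 0)
      + (1 - real N) * (\<Sum>p = 1..N+1. eta N p * xcoef N (\<phi> s) i p * dot k (\<lambda>u. xcoef N u j p) s))"
    by (intro affine_line_add affine_line_cmult affine_line_coord affine_line_mult_constant constant_line_const *)
  then show ?thesis
    by (rule affine_line_cong)
       (simp only: GamS_eq[OF _ assms(2)] sum_xcoef[OF _ assms(1)] sum_dot_xcoef[OF _ assms(2)])
qed

end

theorem theorem10:
  fixes N :: nat and V :: "(nat \<Rightarrow> real) set" and \<phi> :: "(nat \<Rightarrow> real) \<Rightarrow> (nat \<Rightarrow> real)"
  assumes "N \<ge> 2"
    and "open V"
    and "continuous_on V \<phi>"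
    and "\<forall>s\<in>V. \<forall>r\<in>{1..N+1}. sfun N (\<phi> s) r = s r"
    and "\<forall>s\<in>V. jac_nonsing N (\<phi> s)"
    and "s \<in> V"
    and "i \<in> {1..N+1}" and "j \<in> {1..N+1}" and "k \<in> {1..N+1}"
  shows "partial (N - 1) (partial (N - 1) (gS N \<phi> i j)) s = 0
       \<and> partial (N - 1) (partial (N - 1) (GamS N \<phi> i j k)) s = 0"
proof -
  interpret local_inverse N V \<phi>
    using assms by unfold_locales auto
  show ?thesis
    using second_partial_affine[OF affine_line_gS assms(6)] second_partial_affine[OF affine_line_GamS assms(6)] assms
    by blast
qed

end
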